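(* Let $s,L>0$, $m\le n$, and suppose that $B\ge n^{1/(1+2s)}/\log_2 n$ ($m$ and $B$ may depend on $n$); let $M>0$. Let $\hat f$ be the following distributed estimator: every machine $i=1,\dots,m$ transmits $Y^{(i)}_{jk}=\mathrm{TransApprox}(\hat f^{(i)}_{jk})$ for all $(j,k)$ with $2^j+k\le n^{1/(1+2s)}\wedge(B/\log_2 n)$, and the central machine forms $\hat f=\sum_{j,k}\hat f_{jk}\psi_{jk}$ with $\hat f_{jk}=\frac1m\sum_{i=1}^mY^{(i)}_{jk}$ if $2^j+k\le n^{1/(1+2s)}\wedge(B/\log_2 n)$ and $\hat f_{jk}=0$ otherwise. Then $\hat f\in\mathcal F_{dist}(B,\dots,B;B^s_{2,\infty}(L))$ and $$\sup_{f_0\in B^s_{2,\infty}(L),\ \|f_0\|_\infty\le M}\mathbb E_{f_0,T}\|\hat f-f_0\|_2^2\ \lesssim\ L^{\frac{2}{1+2s}}\Big(n^{-\frac{2s}{1+2s}}\vee (B/\log_2 n)^{-2s}\Big),$$ where $\lesssim$ means that the inequality holds up to a universal positive multiplicative constant.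
   Context: Model. The total sample size is $n$ and there are $m$ local machines with $n/m\in\mathbb N$. Machine $i\in\{1,\dots,m\}$ observes pairs $(T^{(i)}_\ell,X^{(i)}_\ell)$, $\ell=1,\dots,n/m$, with $X^{(i)}_\ell=f_0(T^{(i)}_\ell)+\sigma\varepsilon^{(i)}_\ell$, where the $T^{(i)}_\ell$ are iid uniform on $(0,1)$, the $\varepsilon^{(i)}_\ell$ are iid $N(0,1)$, independent of the design, $\sigma>0$, and $f_0\in L_2[0,1]$ is unknown and common to all machines. $\mathbb E_{f_0,T}$ is expectation under the joint law of all data. Distributed estimators. Machine $i$ sends to a central machine a finite binary string $Y^{(i)}$ which is a measurable function of its local data; $l(Y)$ denotes the length of a string $Y$. For $\mathcal F\subset L_2[0,1]$, $\mathcal F_{dist}(B^{(1)},\dots,B^{(m)};\mathcal F)$ is the class of estimators $\hat f$ that are measurable functions of $(Y^{(1)},\dots,Y^{(m)})$ for such strings satisfying $\mathbb E_{f_0,T}[l(Y^{(i)})]\le B^{(i)}$ for all $f_0\in\mathcal F$ and all $i=1,\dots,m$. Wavelets and Besov balls. $\psi_{jk}$ ($j\ge 0$, $0\le k\le 2^j-1$) is a Cohen–Daubechies–Vial compactly supported orthonormal wavelet basis of $L_2[0,1]$ with $N>s$ vanishing moments (coarsest-level scaling functions included in the indexing), $f_{jk}=\langle f,\psi_{jk}\rangle$, $\|f\|_{B^s_{2,\infty}}^2=\sup_{j}2^{2js}\sum_{k=0}^{2^j-1}f_{jk}^2$ and $B^s_{2,\infty}(L)=\{f\in L_2[0,1]:\|f\|_{B^s_{2,\infty}}<L\}$.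 Local estimators: $\hat f^{(i)}_{jk}=\frac mn\sum_{\ell=1}^{n/m}X^{(i)}_\ell\psi_{jk}(T^{(i)}_\ell)$. TransApprox. For $x\in\mathbb R$ with binary expansion $|x|=\sum_{k=-\infty}^{\lfloor\log_2|x|\rfloor}b_k2^k$, $b_k\in\{0,1\}$, $\mathrm{TransApprox}(x)$ transmits the sign bit of $x$ and the digits $b_k$ with $-D\log_2 n\le k\le\log_2|x|$, where $D=1/2$; this encodes the number $y$ having the same sign as $x$ and $|y|=\sum_{-D\log_2 n\le k\le\log_2|x|}b_k2^k$. Its length in bits is at most $1+(1\vee\log_2|x|)+D\log_2 n$. The symbol $Y^{(i)}_{jk}$ is used both for the bit string and for the number $y$ it encodes. Notation. $a\wedge b=\min(a,b)$, $a\vee b=\max(a,b)$. For positive sequences, $a_n\lesssim b_n$ means that there exists a universal positive constant $C$ such that $a_n\le Cb_n$.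
   Formalization: Membership of f̂ in F_dist is asserted only for n ≥ n0(s,L,M,σ), since it fails for small n; the constant in ≲ may depend on s, L, M, σ (a constant independent of L is impossible), uniformly in n, m, B, f_0 and the wavelet basis; the risk bound is for n ≥ 2. *)

theory Defs
  imports "HOL-Probability.Probability"
begin

text \<open>Elements of \<open>L\<^sub>2[0,1]\<close> are represented by Borel functions on the real line of which only
  the restriction to \<open>[0,1]\<close> matters.\<close>

definition L2_unit :: "(real \<Rightarrow> real) set" where
  "L2_unit = {f \<in> borel_measurable borel. set_integrable lborel {0..1} (\<lambda>x. (f x)\<^sup>2)}"

definition inner_unit :: "(real \<Rightarrow> real) \<Rightarrow> (real \<Rightarrow> real) \<Rightarrow> real" where
  "inner_unit f g = (LINT x:{0..1}|lborel. f x * g x)"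

text \<open>Orthonormal systems indexed by \<open>j \<ge> 0\<close>, \<open>0 \<le> k \<le> 2\<^sup>j - 1\<close> whose linear span is dense; the
  values \<open>\<psi> j k\<close> with \<open>k \<ge> 2\<^sup>j\<close> are irrelevant.\<close>

definition orthonormal_basis_unit :: "(nat \<Rightarrow> nat \<Rightarrow> real \<Rightarrow> real) \<Rightarrow> bool" where
  "orthonormal_basis_unit \<psi> \<longleftrightarrow>
     (\<forall>j k. k < 2 ^ j \<longrightarrow> \<psi> j k \<in> L2_unit) \<and>
     (\<forall>j k j' k'. k < 2 ^ j \<longrightarrow> k' < 2 ^ j' \<longrightarrow>
        inner_unit (\<psi> j k) (\<psi> j' k') = (if j = j' \<and> k = k' then 1 else 0)) \<and>
     (\<forall>f \<in> L2_unit. \<forall>e > 0. \<exists>J (c :: nat \<Rightarrow> nat \<Rightarrow> real).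
        (LINT x:{0..1}|lborel. (f x - (\<Sum>j<J. \<Sum>k<2 ^ j. c j k * \<psi> j k x))\<^sup>2) < e)"

text \<open>A Daubechies father and mother wavelet with \<open>N\<close> vanishing moments, translated so that both
  are supported in \<open>[1-N, N]\<close>; \<open>h\<close> is the low-pass filter.\<close>

definition daubechies_pair :: "nat \<Rightarrow> (real \<Rightarrow> real) \<Rightarrow> (real \<Rightarrow> real) \<Rightarrow> bool" where
  "daubechies_pair N \<phi> w \<longleftrightarrow>
     \<phi> \<in> borel_measurable borel \<and> (\<exists>b. \<forall>x. \<bar>\<phi> x\<bar> \<le> b) \<and>
     (\<forall>x. x \<notin> {1 - real N..real N} \<longrightarrow> \<phi> x = 0) \<and>
     (LINT x|lborel. \<phi> x) = 1 \<and>
     (\<forall>k::int. (LINT x|lborel. \<phi> x * \<phi> (x - of_int k)) = (if k = 0 then 1 else 0)) \<and>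
     (\<exists>h :: int \<Rightarrow> real. \<forall>x.
        \<phi> x = sqrt 2 * (\<Sum>k = 1 - int N..int N. h k * \<phi> (2 * x - of_int k)) \<and>
        w x = sqrt 2 * (\<Sum>k = 1 - int N..int N. (-1) powi k * h (1 - k) * \<phi> (2 * x - of_int k))) \<and>
     (\<forall>p < N. (LINT x|lborel. x ^ p * w x) = 0)"

text \<open>Left-edge functions, viewed on the half line \<open>[0,\<infinity>)\<close>. The edge scaling functions are
  obtained by orthonormalising the \<open>N\<close> functions \<open>\<Sum>\<^sub>i (i choose r) \<phi>(x + i - N + 1)\<close>, which
  together with the translates \<open>\<phi>(x - l)\<close>, \<open>l \<ge> N\<close>, reproduce the polynomials of degree less than
  \<open>N\<close>. The edge wavelets belong to the scaling space of the next finer level. All orthogonality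
  relations are imposed on the final basis, in \<open>cdv_basis\<close> below; which orthonormal
  basis of the edge spaces is used is left free. The right edge is treated through the reflection
  \<open>x \<mapsto> 1 - x\<close>.\<close>

definition edge_scaling :: "nat \<Rightarrow> (real \<Rightarrow> real) \<Rightarrow> (nat \<Rightarrow> real \<Rightarrow> real) \<Rightarrow> bool" where
  "edge_scaling N \<phi> \<phi>E \<longleftrightarrow>
     (\<exists>A :: nat \<Rightarrow> nat \<Rightarrow> real. \<forall>k < N. \<forall>x \<ge> 0. \<phi>E k x =
        (\<Sum>r<N. A k r * (\<Sum>i = r..2 * N - 2. real (i choose r) * \<phi> (x + real i - real N + 1))))"

definition edge_wavelet ::
  "nat \<Rightarrow> (real \<Rightarrow> real) \<Rightarrow> (nat \<Rightarrow> real \<Rightarrow> real) \<Rightarrow> (nat \<Rightarrow> real \<Rightarrow> real) \<Rightarrow> bool" where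
  "edge_wavelet N \<phi> \<phi>E wE \<longleftrightarrow>
     (\<exists>G g :: nat \<Rightarrow> nat \<Rightarrow> real. \<forall>k < N. \<forall>x \<ge> 0. wE k x =
        sqrt 2 * ((\<Sum>l<N. G k l * \<phi>E l (2 * x)) +
                  (\<Sum>l = N..3 * N - 2. g k l * \<phi> (2 * x - real l))))"

text \<open>The \<open>2\<^sup>j\<close> functions of level \<open>j\<close>: \<open>N\<close> at the left edge, \<open>2\<^sup>j - 2N\<close> interior ones, and \<open>N\<close> at
  the right edge.\<close>

definition level_fun ::
  "nat \<Rightarrow> (real \<Rightarrow> real) \<Rightarrow> (nat \<Rightarrow> real \<Rightarrow> real) \<Rightarrow> (nat \<Rightarrow> real \<Rightarrow> real) \<Rightarrow>
   nat \<Rightarrow> nat \<Rightarrow> real \<Rightarrow> real" where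
  "level_fun N g gL gR j k x = 2 powr (real j / 2) *
     (if k < N then gL k (2 ^ j * x)
      else if k < 2 ^ j - N then g (2 ^ j * x - real k)
      else gR (2 ^ j - 1 - k) (2 ^ j * (1 - x)))"

text \<open>The basis consists of the \<open>2^j0\<close> scaling functions of a coarsest level \<open>j0\<close> and the
  \<open>2^i\<close> wavelets of every level \<open>i \<ge> j0\<close>. In the enumeration \<open>e\<close> the scaling functions occupy the
  positions \<open>0, \<dots>, 2^j0 - 1\<close> and the \<open>k\<close>-th wavelet of level \<open>i\<close> has position \<open>2^i + k\<close>. The pairs
  \<open>(j,k)\<close> with \<open>k < 2^j\<close> are in bijection, by \<open>2^j + k\<close>, with the positive integers, so the basis
  is indexed by them after a shift by one.\<close>

definition cdv_basis :: "nat \<Rightarrow> (nat \<Rightarrow> nat \<Rightarrow> real \<Rightarrow> real) \<Rightarrow> bool" where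
  "cdv_basis N \<psi> \<longleftrightarrow>
     (\<exists>j0 \<phi> w \<phi>L \<phi>R wL wR (e :: nat \<Rightarrow> real \<Rightarrow> real).
        1 \<le> N \<and> 2 * N \<le> 2 ^ j0 \<and>
        daubechies_pair N \<phi> w \<and>
        edge_scaling N \<phi> \<phi>L \<and> edge_scaling N (\<lambda>x. \<phi> (1 - x)) \<phi>R \<and>
        edge_wavelet N \<phi> \<phi>L wL \<and> edge_wavelet N (\<lambda>x. \<phi> (1 - x)) \<phi>R wR \<and>
        (\<forall>k < 2 ^ j0. e k = level_fun N \<phi> \<phi>L \<phi>R j0 k) \<and>
        (\<forall>i \<ge> j0. \<forall>k < 2 ^ i. e (2 ^ i + k) = level_fun N w wL wR i k) \<and>
        (\<forall>j k. k < 2 ^ j \<longrightarrow> (\<forall>x \<in> {0..1}. \<psi> j k x = e (2 ^ j + k - 1) x))) \<and>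
     orthonormal_basis_unit \<psi>"

definition besov_norm_sq :: "real \<Rightarrow> (nat \<Rightarrow> nat \<Rightarrow> real \<Rightarrow> real) \<Rightarrow> (real \<Rightarrow> real) \<Rightarrow> ennreal" where
  "besov_norm_sq s \<psi> f =
     (SUP j. ennreal (2 powr (2 * real j * s) * (\<Sum>k<2 ^ j. (inner_unit f (\<psi> j k))\<^sup>2)))"

definition besov_ball :: "real \<Rightarrow> (nat \<Rightarrow> nat \<Rightarrow> real \<Rightarrow> real) \<Rightarrow> real \<Rightarrow> (real \<Rightarrow> real) set" where
  "besov_ball s \<psi> L = {f \<in> L2_unit. besov_norm_sq s \<psi> f < ennreal (L\<^sup>2)}"

definition obs_law :: "real \<Rightarrow> (real \<Rightarrow> real) \<Rightarrow> (real \<times> real) measure" where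
  "obs_law \<sigma> f0 =
     distr (uniform_measure lborel {0<..<1} \<Otimes>\<^sub>M density lborel (\<lambda>x. ennreal (std_normal_density x)))
           borel (\<lambda>(t, e). (t, f0 t + \<sigma> * e))"

text \<open>Machines are numbered \<open>0, \<dots>, m-1\<close> and observations \<open>0, \<dots>, n/m - 1\<close>; \<open>d i l\<close> is the pair
  \<open>(T, X)\<close> of the \<open>l\<close>-th observation on machine \<open>i\<close>.\<close>

type_synonym local_data = "nat \<Rightarrow> real \<times> real"

definition local_space :: "nat \<Rightarrow> nat \<Rightarrow> local_data measure" where
  "local_space n m = (\<Pi>\<^sub>M l\<in>{..<n div m}. borel)"

definition data_law :: "real \<Rightarrow> nat \<Rightarrow> nat \<Rightarrow> (real \<Rightarrow> real) \<Rightarrow> (nat \<Rightarrow> local_data) measure" where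
  "data_law \<sigma> n m f0 = (\<Pi>\<^sub>M i\<in>{..<m}. \<Pi>\<^sub>M l\<in>{..<n div m}. obs_law \<sigma> f0)"

text \<open>Joint measurability of \<open>(y, t) \<mapsto> g y t\<close> renders measurability of the \<open>L\<^sub>2[0,1]\<close>-valued map
  \<open>g\<close>. Expectations are nonnegative integrals, so a finite bound includes finiteness.\<close>

definition dist_estimators ::
  "real \<Rightarrow> nat \<Rightarrow> nat \<Rightarrow> (nat \<Rightarrow> real) \<Rightarrow> (real \<Rightarrow> real) set \<Rightarrow>
   ((nat \<Rightarrow> local_data) \<Rightarrow> real \<Rightarrow> real) set" where
  "dist_estimators \<sigma> n m B F =
     {fhat. \<exists>(Y :: nat \<Rightarrow> local_data \<Rightarrow> bool list) (g :: (nat \<Rightarrow> bool list) \<Rightarrow> real \<Rightarrow> real).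
        (\<forall>i < m. Y i \<in> local_space n m \<rightarrow>\<^sub>M count_space UNIV) \<and>
        (\<lambda>(y, t). g y t) \<in> borel_measurable ((\<Pi>\<^sub>M i\<in>{..<m}. count_space UNIV) \<Otimes>\<^sub>M borel) \<and>
        (\<forall>y. g y \<in> L2_unit) \<and>
        (\<forall>d \<in> space (\<Pi>\<^sub>M i\<in>{..<m}. local_space n m).
           fhat d = g (\<lambda>i\<in>{..<m}. Y i (d i))) \<and>
        (\<forall>f0 \<in> F. \<forall>i < m.
           (\<integral>\<^sup>+ d. of_nat (length (Y i (d i))) \<partial>data_law \<sigma> n m f0) \<le> ennreal (B i))}"

definition risk ::
  "real \<Rightarrow> nat \<Rightarrow> nat \<Rightarrow> ((nat \<Rightarrow> local_data) \<Rightarrow> real \<Rightarrow> real) \<Rightarrow> (real \<Rightarrow> real) \<Rightarrow> ennreal" where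
  "risk \<sigma> n m fhat f0 =
     (\<integral>\<^sup>+ d. (\<integral>\<^sup>+ t\<in>{0..1}. ennreal ((fhat d t - f0 t)\<^sup>2) \<partial>lborel) \<partial>data_law \<sigma> n m f0)"

text \<open>The digit of \<open>\<bar>x\<bar>\<close> at \<open>2\<^sup>k\<close> is the parity of \<open>\<lfloor>\<bar>x\<bar> / 2\<^sup>k\<rfloor>\<close> (for dyadic rationals this selects the
  terminating expansion). The digits are listed from the least significant one upwards, so that a
  string can be decoded from the knowledge of \<open>n\<close> alone. The case \<open>x = 0\<close> is separated because
  \<open>log 2 0 = 0\<close> in the library, not \<open>-\<infinity>\<close>.\<close>

definition low_digit :: "nat \<Rightarrow> int" where
  "low_digit n = \<lceil>- (1 / 2) * log 2 (real n)\<rceil>"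

definition trans_approx :: "nat \<Rightarrow> real \<Rightarrow> bool list" where
  "trans_approx n x =
     (x < 0) # (if x = 0 then []
                else map (\<lambda>k. odd \<lfloor>\<bar>x\<bar> / 2 powi k\<rfloor>) [low_digit n..\<lfloor>log 2 \<bar>x\<bar>\<rfloor>])"

definition trans_value :: "nat \<Rightarrow> bool list \<Rightarrow> real" where
  "trans_value n y =
     (case y of [] \<Rightarrow> 0
      | b # ds \<Rightarrow> (if b then -1 else 1) *
          (\<Sum>i<length ds. of_bool (ds ! i) * 2 powi (low_digit n + int i)))"

definition local_coeff ::
  "(nat \<Rightarrow> nat \<Rightarrow> real \<Rightarrow> real) \<Rightarrow> nat \<Rightarrow> nat \<Rightarrow> local_data \<Rightarrow> nat \<Rightarrow> nat \<Rightarrow> real" where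
  "local_coeff \<psi> n m d j k =
     real m / real n * (\<Sum>l<n div m. snd (d l) * \<psi> j k (fst (d l)))"

definition sent_indices :: "real \<Rightarrow> nat \<Rightarrow> real \<Rightarrow> (nat \<times> nat) set" where
  "sent_indices s n B =
     {(j, k). k < 2 ^ j \<and>
        real (2 ^ j + k) \<le> min (real n powr (1 / (1 + 2 * s))) (B / log 2 (real n))}"

definition dist_estimator ::
  "(nat \<Rightarrow> nat \<Rightarrow> real \<Rightarrow> real) \<Rightarrow> real \<Rightarrow> nat \<Rightarrow> nat \<Rightarrow> real \<Rightarrow> (nat \<Rightarrow> local_data) \<Rightarrow> real \<Rightarrow> real" where
  "dist_estimator \<psi> s n m B d t =
     (\<Sum>(j, k)\<in>sent_indices s n B.
        (1 / real m * (\<Sum>i<m. trans_value n (trans_approx n (local_coeff \<psi> n m (d i) j k)))) *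
        \<psi> j k t)"

end

theory Submission
  imports Defs
begin

text \<open>By orthonormality the loss splits into the squared errors of the transmitted coefficients plus
  the squared norm of the part of \<open>f0\<close> that is not transmitted. Write \<open>K\<close> for the minimum of
  \<open>n powr (1 / (1 + 2 * s))\<close> and \<open>B / log 2 n\<close>. At most \<open>K\<close> coefficients are sent; each is estimated by
  averaging \<open>n\<close> independent terms of bounded second moment, up to a rounding error below
  \<open>2 / sqrt n\<close>, which costs \<open>O(K / n)\<close> in total. All levels below the one of size about \<open>K\<close> are sent
  completely, so a geometric series bounds the rest by \<open>O(K powr (- 2 * s))\<close>.

  For the transmission budget, the first moment of a local coefficient is bounded uniformly over the
  Besov ball. Hence a codeword whose length is \<open>log 2 n / 2\<close> plus a term linear in the absolute value
  has expected length below \<open>log 2 n\<close> for large \<open>n\<close>.\<close>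

section \<open>Rounding and prefix-free coding\<close>

text \<open>The obstacle is the difference between a transmitted number and the bits that carry it.
  Cutting a concatenation of \<open>trans_approx\<close> strings apart requires their lengths, which
  depend on the unknown numbers. But \<open>dist_estimators\<close> asks only for some strings from
  which the estimator can be computed, and \<open>dist_estimator\<close> sees the data only through
  \<open>trans_value n (trans_approx n x)\<close>. This value is \<open>x\<close> truncated toward
  zero to \<open>precision n\<close> binary places, so any decodable code for the truncated number
  can replace the original string. The choice of half of \<open>log 2 n\<close> binary places
  balances both sides: the squared truncation error is of order \<open>1 / n\<close>, like the
  variance of an average over all observations, and half of the \<open>log 2 n\<close> bits
  available per coefficient stays free for sign, integer part and end marker. The budget must hold
  on the whole Besov ball, where no bound \<open>M\<close> is given, so it rests on first moments,
  which the norm in \<open>L2_unit\<close> controls. The variance needs second moments of a product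
  of response and wavelet; there \<open>M\<close> enters.\<close>

definition precision :: "nat \<Rightarrow> nat" where
  "precision n = nat \<lfloor>log 2 (real n) / 2\<rfloor>"

lemma low_digit_eq_precision:
  assumes "1 \<le> n" shows "low_digit n = - int (precision n)"
proof -
  have "0 \<le> log 2 (real n)" using assms by simp
  then have "0 \<le> \<lfloor>log 2 (real n) / 2\<rfloor>" by simp
  then show ?thesis unfolding low_digit_def precision_def
    by (simp add: ceiling_minus)
qed

lemma precision_le:
  assumes "1 \<le> n" shows "real (precision n) \<le> log 2 (real n) / 2"
proof -
  have "0 \<le> log 2 (real n)" using assms by simp
  then have "0 \<le> \<lfloor>log 2 (real n) / 2\<rfloor>" by simp
  then show ?thesis unfolding precision_def by linarith
qed

text \<open>Rounding \<open>log 2 n / 2\<close> down loses less than one binary place, a factor 2 in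
  the error and hence 4 in its square.\<close>

lemma inverse_power_precision_le:
  assumes "1 \<le> n" shows "(1 / 2 ^ precision n)\<^sup>2 \<le> 4 / real n"
proof -
  have "log 2 (real n) / 2 < real (precision n) + 1"
    using assms by (simp add: precision_def)
  then have "log 2 (real n) \<le> real (2 * precision n + 2)" by simp
  then have "2 powr log 2 (real n) \<le> 2 powr real (2 * precision n + 2)"
    by (rule powr_mono) simp
  then have "real n \<le> 2 ^ (2 * precision n + 2)"
    using assms by (subst (asm) powr_realpow) simp_all
  then have "real n \<le> 4 * (2 ^ precision n)\<^sup>2"
    by (simp add: power_add power_mult power2_eq_square power_mult_distrib mult.commute power_even_eq)
  then show ?thesis using assms by (simp add: power_divide divide_simps mult.commute)
qed

text \<open>The sum telescopes: a parity bit is \<open>y - 2 * (y div 2)\<close>, and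
  \<open>y div 2\<close> is the floor that belongs to the next digit.\<close>

lemma sum_binary_digits:
  fixes a :: real and lo :: int
  shows "(\<Sum>i<r. of_bool (odd \<lfloor>a / 2 powi (lo + int i)\<rfloor>) * 2 powi (lo + int i)) =
    (2 powi lo :: real) * of_int \<lfloor>a / 2 powi lo\<rfloor> - 2 powi (lo + int r) * of_int \<lfloor>a / 2 powi (lo + int r)\<rfloor>"
proof (induction r)
  case 0 show ?case by simp
next
  case (Suc r)
  define y where "y = \<lfloor>a / 2 powi (lo + int r)\<rfloor>"
  have p: "(2::real) powi (lo + int (Suc r)) = 2 * 2 powi (lo + int r)"
    by (simp add: power_int_add)
  have "\<lfloor>a / 2 powi (lo + int (Suc r))\<rfloor> = \<lfloor>a / 2 powi (lo + int r) / real_of_int 2\<rfloor>"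
    unfolding p by (simp add: field_simps)
  also have "\<dots> = y div 2" unfolding y_def by (rule floor_divide_real_eq_div) simp
  finally have f: "\<lfloor>a / 2 powi (lo + int (Suc r))\<rfloor> = y div 2" .
  have "y = 2 * (y div 2) + of_bool (odd y)" by (simp add: mod_2_eq_odd[symmetric])
  then have "real_of_int y = 2 * real_of_int (y div 2) + of_bool (odd y)"
    by (metis of_int_add of_int_mult of_int_numeral of_int_of_bool)
  moreover have "2 powi (lo + int (Suc r)) * of_int \<lfloor>a / 2 powi (lo + int (Suc r))\<rfloor> =
      2 * 2 powi (lo + int r) * real_of_int (y div 2)" by (subst f, subst p) (rule refl)
  ultimately show ?case unfolding sum.lessThan_Suc Suc y_def[symmetric] by (simp add: algebra_simps)
qed

text \<open>The pair of sign and natural number stands between the real number and its bit string,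
  so that the code can be exchanged without touching the value. The sign is kept apart because
  truncation is toward zero.\<close>

definition round_value :: "nat \<Rightarrow> bool \<times> nat \<Rightarrow> real" where
  "round_value h = (\<lambda>(b, v). (if b then - 1 else 1) * (real v / 2 ^ h))"

definition round_symbol :: "nat \<Rightarrow> real \<Rightarrow> bool \<times> nat" where
  "round_symbol h x = (x < 0, nat \<lfloor>\<bar>x\<bar> * 2 ^ h\<rfloor>)"

text \<open>The telescoping sum leaves the floor at the lowest digit, which is the truncation, minus
  the floor above the highest digit, which is 0. From here on the digit lists are no longer
  needed.\<close>

lemma trans_value_trans_approx:
  assumes "1 \<le> n"
  shows "trans_value n (trans_approx n x) = round_value (precision n) (round_symbol (precision n) x)"
proof (cases "x = 0")
  case True then show ?thesis
    by (simp add: trans_approx_def trans_value_def round_value_def round_symbol_def)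
next
  case False
  define h where "h = precision n"
  define lo where "lo = low_digit n"
  have lo: "lo = - int h" by (simp add: lo_def h_def low_digit_eq_precision[OF assms])
  define hi where "hi = \<lfloor>log 2 \<bar>x\<bar>\<rfloor>"
  define r where "r = nat (hi - lo + 1)"
  have val: "trans_value n (trans_approx n x) = (if x < 0 then - 1 else 1) *
     (\<Sum>i<r. of_bool (odd \<lfloor>\<bar>x\<bar> / 2 powi (lo + int i)\<rfloor>) * 2 powi (lo + int i))"
  proof -
    define ds where "ds = map (\<lambda>k. odd \<lfloor>\<bar>x\<bar> / 2 powi k\<rfloor>) [lo..hi]"
    have "trans_approx n x = (x < 0) # ds"
      using False by (simp add: trans_approx_def lo_def[symmetric] hi_def[symmetric] ds_def)
    moreover have "length ds = r" by (simp add: ds_def r_def)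
    ultimately have "trans_value n (trans_approx n x) = (if x < 0 then - 1 else 1) *
        (\<Sum>i<r. of_bool (ds ! i) * 2 powi (lo + int i))"
      by (simp only: trans_value_def lo_def[symmetric] list.case)
    also have "(\<Sum>i<r. of_bool (ds ! i) * 2 powi (lo + int i)) =
        (\<Sum>i<r. of_bool (odd \<lfloor>\<bar>x\<bar> / 2 powi (lo + int i)\<rfloor>) * (2 powi (lo + int i) :: real))"
      by (rule sum.cong) (auto simp: ds_def r_def nth_upto)
    finally show ?thesis .
  qed
  \<comment> \<open>If \<open>x\<close> is so small that no digit is listed, \<open>r\<close> is 0
    because \<open>nat\<close> cuts off negative numbers, and \<open>lo\<close> itself is already at
    least \<open>hi + 1\<close>. One inequality thus covers both cases.\<close>
  have "log 2 \<bar>x\<bar> < real_of_int (hi + 1)" unfolding hi_def by linarith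
  also have "\<dots> \<le> real_of_int (lo + int r)" unfolding r_def by linarith
  finally have "\<bar>x\<bar> < 2 powr real_of_int (lo + int r)" using False by (simp add: log_less_iff)
  then have "\<bar>x\<bar> < 2 powi (lo + int r)"
    using powr_real_of_int'[of "2::real" "lo + int r"] by (simp only: zero_le_numeral) simp
  then have z: "\<lfloor>\<bar>x\<bar> / 2 powi (lo + int r)\<rfloor> = 0" by (simp add: floor_eq_iff)
  have lo': "(2::real) powi lo = 1 / 2 ^ h" unfolding lo by (simp add: power_int_minus field_simps)
  show ?thesis unfolding val sum_binary_digits z lo' h_def[symmetric]
    by (simp add: round_value_def round_symbol_def)
qed

lemma round_error: "\<bar>round_value h (round_symbol h x) - x\<bar> \<le> 1 / 2 ^ h"
proof -
  have "real_of_int \<lfloor>\<bar>x\<bar> * 2 ^ h\<rfloor> \<le> \<bar>x\<bar> * 2 ^ h" "\<bar>x\<bar> * 2 ^ h \<le> real_of_int \<lfloor>\<bar>x\<bar> * 2 ^ h\<rfloor> + 1"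
    by linarith+
  then have "real_of_int \<lfloor>\<bar>x\<bar> * 2 ^ h\<rfloor> / 2 ^ h \<le> \<bar>x\<bar>" "\<bar>x\<bar> \<le> real_of_int \<lfloor>\<bar>x\<bar> * 2 ^ h\<rfloor> / 2 ^ h + 1 / 2 ^ h"
    by (simp_all add: field_simps)
  then show ?thesis unfolding round_value_def round_symbol_def
    by (auto simp: abs_if split: if_splits)
qed

text \<open>A Golomb-Rice code: sign, integer part in unary, then the \<open>h\<close> fractional digits. Its
  codewords can be concatenated without separators, unlike the strings of \<^const>\<open>trans_approx\<close>.\<close>

definition rice_code :: "nat \<Rightarrow> bool \<times> nat \<Rightarrow> bool list" where
  "rice_code h = (\<lambda>(b, v). b # replicate (v div 2 ^ h) True @ False # map (bit (v mod 2 ^ h)) [0..<h])"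

lemma replicate_append_False_cancel:
  "replicate q True @ False # ys = replicate q' True @ False # ys' \<Longrightarrow> q = q' \<and> ys = ys'"
proof (induction q arbitrary: q')
  case 0 then show ?case by (cases q') auto
next
  case (Suc q) then show ?case by (cases q') auto
qed

text \<open>The code is prefix-free: one sign bit, a unary part that ends at the first
  \<open>False\<close>, and a block whose length \<open>h\<close> is known in advance. Quotient and
  remainder modulo \<open>2 ^ h\<close> then determine the number.\<close>

lemma rice_code_append_cancel:
  assumes "rice_code h z @ r = rice_code h z' @ r'"
  shows "z = z' \<and> r = r'"
proof -
  obtain b v b' v' where z: "z = (b, v)" "z' = (b', v')" by fastforce
  have eq: "b = b'" "v div 2 ^ h = v' div 2 ^ h"
    "map (bit (v mod 2 ^ h)) [0..<h] @ r = map (bit (v' mod 2 ^ h)) [0..<h] @ r'"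
    using assms replicate_append_False_cancel[of "v div 2 ^ h" "map (bit (v mod 2 ^ h)) [0..<h] @ r"
        "v' div 2 ^ h" "map (bit (v' mod 2 ^ h)) [0..<h] @ r'"]
    unfolding z rice_code_def by simp_all
  then have r: "r = r'" and m: "map (bit (v mod 2 ^ h)) [0..<h] = map (bit (v' mod 2 ^ h)) [0..<h]"
    by simp_all
  have "v mod 2 ^ h = v' mod 2 ^ h"
  proof (rule bit_eqI)
    fix k show "bit (v mod 2 ^ h) k = bit (v' mod 2 ^ h) k"
      using m by (cases "k < h") (auto simp: take_bit_eq_mod[symmetric] bit_take_bit_iff)
  qed
  then have "v = v'" using eq(2) by (metis div_mult_mod_eq[of v "2 ^ h"] div_mult_mod_eq[of v' "2 ^ h"])
  with eq r show ?thesis unfolding z by simp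
qed

lemma concat_rice_code_cancel:
  "concat (map (\<lambda>p. rice_code h (z p)) ps) = concat (map (\<lambda>p. rice_code h (z' p)) ps) \<Longrightarrow>
   p \<in> set ps \<Longrightarrow> z p = z' p"
  by (induction ps) (auto dest: rice_code_append_cancel)

text \<open>The 2 counts the sign bit and the end of the unary part. Unary is wasteful for large
  numbers, but its linear cost turns a bound on the expected length into a bound on the first
  absolute moment.\<close>

lemma length_rice_code_le: "real (length (rice_code h (round_symbol h x))) \<le> 2 + real h + \<bar>x\<bar>"
proof -
  define v where "v = nat \<lfloor>\<bar>x\<bar> * 2 ^ h\<rfloor>"
  have "real (v div 2 ^ h) \<le> real v / 2 ^ h"
    using of_nat_div_le_of_nat[of v "2 ^ h"] by simp
  also have "\<dots> \<le> \<bar>x\<bar>" unfolding v_def by (simp add: field_simps)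
  finally show ?thesis unfolding rice_code_def round_symbol_def v_def[symmetric] by simp
qed

definition send :: "nat \<Rightarrow> 'a list \<Rightarrow> ('a \<Rightarrow> real) \<Rightarrow> bool list" where
  "send h ps x = concat (map (\<lambda>p. rice_code h (round_symbol h (x p))) ps)"

text \<open>Decoding by choice: unique decodability fixes the chosen symbols at the members of
  \<open>ps\<close>, and the function is still total on strings that are no codewords. Measurability
  is no concern, since strings carry the discrete sigma-algebra.\<close>

definition receive :: "nat \<Rightarrow> 'a list \<Rightarrow> bool list \<Rightarrow> 'a \<Rightarrow> real" where
  "receive h ps y p = round_value h ((SOME z. concat (map (\<lambda>p. rice_code h (z p)) ps) = y) p)"

lemma receive_send:
  assumes "p \<in> set ps"
  shows "receive h ps (send h ps x) p = round_value h (round_symbol h (x p))"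
proof -
  let ?z = "SOME z. concat (map (\<lambda>p. rice_code h (z p)) ps) = send h ps x"
  have "concat (map (\<lambda>p. rice_code h (?z p)) ps) = send h ps x"
    by (rule someI[of _ "\<lambda>p. round_symbol h (x p)"]) (simp add: send_def)
  then have "?z p = round_symbol h (x p)"
    unfolding send_def using assms by (rule concat_rice_code_cancel)
  then show ?thesis by (simp add: receive_def)
qed

lemma length_send_le:
  assumes "distinct ps"
  shows "real (length (send h ps x)) \<le> (\<Sum>p\<in>set ps. 2 + real h + \<bar>x p\<bar>)"
proof -
  have "length (send h ps x) = (\<Sum>p\<in>set ps. length (rice_code h (round_symbol h (x p))))"
    by (simp add: send_def length_concat comp_def sum_list_distinct_conv_sum_set assms)
  then show ?thesis using length_rice_code_le by (auto intro!: sum_mono)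
qed

text \<open>Each message factors through countable discrete spaces, on which every map is
  measurable; the only real work is the measurability of sign and floor. Countability makes the
  product of two discrete spaces discrete again.\<close>

lemma measurable_send:
  assumes "\<And>p. p \<in> set ps \<Longrightarrow> (\<lambda>d. x d p) \<in> borel_measurable M"
  shows "(\<lambda>d. send h ps (x d)) \<in> M \<rightarrow>\<^sub>M count_space UNIV"
  using assms
proof (induction ps)
  case Nil then show ?case by (simp add: send_def)
next
  case (Cons p ps)
  have [measurable]: "(\<lambda>d. x d p) \<in> borel_measurable M" using Cons by simp
  have [measurable]: "(\<lambda>d. send h ps (x d)) \<in> M \<rightarrow>\<^sub>M count_space UNIV" using Cons by simp
  have [measurable]: "(\<lambda>d. rice_code h (x d p < 0, nat \<lfloor>\<bar>x d p\<bar> * 2 ^ h\<rfloor>)) \<in> M \<rightarrow>\<^sub>M count_space UNIV"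
  proof -
    have "(\<lambda>d. (x d p < 0, nat \<lfloor>\<bar>x d p\<bar> * 2 ^ h\<rfloor>)) \<in> M \<rightarrow>\<^sub>M (count_space UNIV \<Otimes>\<^sub>M count_space UNIV)"
      by measurable
    then have "(\<lambda>d. (x d p < 0, nat \<lfloor>\<bar>x d p\<bar> * 2 ^ h\<rfloor>)) \<in> M \<rightarrow>\<^sub>M count_space UNIV"
      by (simp add: pair_measure_countable)
    then show ?thesis by (rule measurable_compose) simp
  qed
  have "(\<lambda>d. (rice_code h (round_symbol h (x d p)), send h ps (x d)))
      \<in> M \<rightarrow>\<^sub>M (count_space UNIV \<Otimes>\<^sub>M count_space UNIV)"
    unfolding round_symbol_def by measurable
  then have "(\<lambda>d. (rice_code h (round_symbol h (x d p)), send h ps (x d))) \<in> M \<rightarrow>\<^sub>M count_space UNIV"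
    by (simp add: pair_measure_countable)
  then have "(\<lambda>d. case (rice_code h (round_symbol h (x d p)), send h ps (x d)) of (u, v) \<Rightarrow> u @ v)
      \<in> M \<rightarrow>\<^sub>M count_space UNIV" by (rule measurable_compose) simp
  then show ?case by (simp add: send_def)
qed

section \<open>Square-integrable functions on the unit interval\<close>

text \<open>The design law lives on the open interval, whereas inner products and losses integrate
  over the closed one. The endpoints are null sets, so this single probability measure serves for
  both.\<close>

definition unit_law :: "real measure" where
  "unit_law = uniform_measure lborel {0<..<1}"

lemma sets_unit_law [simp, measurable_cong]: "sets unit_law = sets borel"
  by (simp add: unit_law_def)

lemma space_unit_law [simp]: "space unit_law = UNIV"
  by (simp add: unit_law_def)

lemma prob_space_unit_law: "prob_space unit_law"
  unfolding unit_law_def by (rule prob_space_uniform_measure) auto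

lemma unit_law_eq_density: "unit_law = density lborel (\<lambda>x. ennreal (indicator {0..1} x))"
  unfolding unit_law_def uniform_measure_def
proof (rule density_cong)
  have "AE x in lborel. x \<noteq> (0::real)" "AE x in lborel. x \<noteq> (1::real)"
    by (rule AE_lborel_singleton)+
  then show "AE x in lborel. indicator {0<..<1} x / emeasure lborel {0<..<1::real} = ennreal (indicator {0..1} (x::real))"
    by eventually_elim (auto simp: indicator_def)
qed auto

lemma nn_integral_unit_law:
  assumes [measurable]: "f \<in> borel_measurable borel"
  shows "(\<integral>\<^sup>+x\<in>{0..1}. f x \<partial>lborel) = (\<integral>\<^sup>+x. f x \<partial>unit_law)"
  unfolding unit_law_eq_density
  by (subst nn_integral_density) (auto simp: ennreal_indicator mult.commute intro!: nn_integral_cong)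

lemma set_integral_unit_law:
  fixes f :: "real \<Rightarrow> real"
  assumes [measurable]: "f \<in> borel_measurable borel"
  shows "(LINT x:{0..1}|lborel. f x) = (\<integral>x. f x \<partial>unit_law)"
  unfolding unit_law_eq_density set_lebesgue_integral_def by (subst integral_density) auto

lemma set_integrable_unit_law:
  fixes f :: "real \<Rightarrow> real"
  assumes [measurable]: "f \<in> borel_measurable borel"
  shows "set_integrable lborel {0..1} f \<longleftrightarrow> integrable unit_law f"
  unfolding unit_law_eq_density set_integrable_def by (subst integrable_density) auto

lemma L2_unit_iff:
  "f \<in> L2_unit \<longleftrightarrow> f \<in> borel_measurable borel \<and> integrable unit_law (\<lambda>x. (f x)\<^sup>2)"
  unfolding L2_unit_def by (auto simp: set_integrable_unit_law)

lemma L2_unit_measurable: "f \<in> L2_unit \<Longrightarrow> f \<in> borel_measurable borel"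
  by (simp add: L2_unit_iff)

lemma L2_unit_integrable_mult:
  assumes "f \<in> L2_unit" "g \<in> L2_unit"
  shows "integrable unit_law (\<lambda>x. f x * g x)"
proof (rule Bochner_Integration.integrable_bound)
  show "integrable unit_law (\<lambda>x. (f x)\<^sup>2 + (g x)\<^sup>2)" using assms by (simp add: L2_unit_iff)
  show "(\<lambda>x. f x * g x) \<in> borel_measurable unit_law"
    using assms[THEN L2_unit_measurable] by measurable
  show "AE x in unit_law. norm (f x * g x) \<le> norm ((f x)\<^sup>2 + (g x)\<^sup>2)"
  proof (rule AE_I2)
    fix x show "norm (f x * g x) \<le> norm ((f x)\<^sup>2 + (g x)\<^sup>2)"
      using sum_squares_bound[of "\<bar>f x\<bar>" "\<bar>g x\<bar>"] mult_nonneg_nonneg[of "\<bar>f x\<bar>" "\<bar>g x\<bar>"]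
      unfolding real_norm_def abs_mult power2_abs by linarith
  qed
qed

lemma inner_unit_eq:
  "f \<in> L2_unit \<Longrightarrow> g \<in> L2_unit \<Longrightarrow> inner_unit f g = (\<integral>x. f x * g x \<partial>unit_law)"
  unfolding inner_unit_def by (intro set_integral_unit_law borel_measurable_times L2_unit_measurable)

lemma L2_unit_mult_left:
  assumes "f \<in> L2_unit" shows "(\<lambda>x. c * f x) \<in> L2_unit"
  using assms by (auto simp: L2_unit_iff power_mult_distrib)

lemma L2_unit_add:
  assumes "f \<in> L2_unit" "g \<in> L2_unit" shows "(\<lambda>x. f x + g x) \<in> L2_unit"
proof -
  have "integrable unit_law (\<lambda>x. (f x)\<^sup>2 + (g x)\<^sup>2 + 2 * (f x * g x))"
    using assms L2_unit_integrable_mult[OF assms] by (auto simp: L2_unit_iff)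
  moreover have "(\<lambda>x. f x + g x) \<in> borel_measurable borel"
    using assms[THEN L2_unit_measurable] by measurable
  ultimately show ?thesis by (simp add: L2_unit_iff power2_sum mult.assoc)
qed

lemma L2_unit_sum:
  assumes "finite S" "\<And>p. p \<in> S \<Longrightarrow> f p \<in> L2_unit"
  shows "(\<lambda>x. \<Sum>p\<in>S. f p x) \<in> L2_unit"
  using assms
proof (induction S)
  case empty then show ?case by (simp add: L2_unit_iff)
next
  case (insert p S)
  then show ?case using L2_unit_add[of "f p" "\<lambda>x. \<Sum>p\<in>S. f p x"] by simp
qed

lemma L2_unit_diff_sum:
  assumes "f \<in> L2_unit" "finite S" "\<And>p. p \<in> S \<Longrightarrow> e p \<in> L2_unit"
  shows "(\<lambda>x. f x - (\<Sum>p\<in>S. a p * e p x)) \<in> L2_unit"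
proof -
  have "(\<lambda>x. \<Sum>p\<in>S. a p * e p x) \<in> L2_unit"
    using assms by (intro L2_unit_sum L2_unit_mult_left) auto
  from L2_unit_add[OF assms(1) L2_unit_mult_left[OF this, of "-1"]] show ?thesis by simp
qed

text \<open>Expand the square and complete it in every coefficient. The weights \<open>a\<close> are
  arbitrary: estimated coefficients give the loss, coefficients of an approximation give the norm
  bound below, and the true coefficients give Bessel's inequality.\<close>

lemma integral_square_diff_orthonormal:
  assumes f: "f \<in> L2_unit" and S: "finite S" and e: "\<And>p. p \<in> S \<Longrightarrow> e p \<in> L2_unit"
    and on: "\<And>p q. p \<in> S \<Longrightarrow> q \<in> S \<Longrightarrow> inner_unit (e p) (e q) = (if p = q then 1 else 0)"
  shows "(\<integral>x. (f x - (\<Sum>p\<in>S. a p * e p x))\<^sup>2 \<partial>unit_law) =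
    (\<integral>x. (f x)\<^sup>2 \<partial>unit_law) - (\<Sum>p\<in>S. (inner_unit f (e p))\<^sup>2) + (\<Sum>p\<in>S. (a p - inner_unit f (e p))\<^sup>2)"
proof -
  have [simp]: "integrable unit_law (\<lambda>x. f x * e p x)" if "p \<in> S" for p
    using f e that by (intro L2_unit_integrable_mult) auto
  have [simp]: "integrable unit_law (\<lambda>x. e p x * e q x)" if "p \<in> S" "q \<in> S" for p q
    using e that by (intro L2_unit_integrable_mult) auto
  have [simp]: "integrable unit_law (\<lambda>x. (f x)\<^sup>2)" using f by (simp add: L2_unit_iff)
  have expand: "(f x - (\<Sum>p\<in>S. a p * e p x))\<^sup>2 = (f x)\<^sup>2 - 2 * (\<Sum>p\<in>S. a p * (f x * e p x)) +
      (\<Sum>p\<in>S. \<Sum>q\<in>S. a p * a q * (e p x * e q x))" for x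
    unfolding power2_diff
    by (simp add: power2_eq_square sum_product sum_distrib_left mult_ac)
  have "(\<integral>x. (f x - (\<Sum>p\<in>S. a p * e p x))\<^sup>2 \<partial>unit_law) =
      (\<integral>x. (f x)\<^sup>2 \<partial>unit_law) - 2 * (\<Sum>p\<in>S. a p * (\<integral>x. f x * e p x \<partial>unit_law)) +
      (\<Sum>p\<in>S. \<Sum>q\<in>S. a p * a q * (\<integral>x. e p x * e q x \<partial>unit_law))"
    unfolding expand by simp
  also have "(\<Sum>p\<in>S. a p * (\<integral>x. f x * e p x \<partial>unit_law)) = (\<Sum>p\<in>S. a p * inner_unit f (e p))"
    using f e by (intro sum.cong) (simp_all add: inner_unit_eq)
  also have "(\<Sum>p\<in>S. \<Sum>q\<in>S. a p * a q * (\<integral>x. e p x * e q x \<partial>unit_law)) =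
      (\<Sum>p\<in>S. \<Sum>q\<in>S. a p * a q * (if p = q then 1 else 0))"
    using e by (intro sum.cong refl) (simp_all add: inner_unit_eq on[symmetric])
  also have "\<dots> = (\<Sum>p\<in>S. (a p)\<^sup>2)"
    using S by (simp add: if_distrib[where f="\<lambda>c. _ * c"] power2_eq_square cong: if_cong)
  finally show ?thesis
    by (simp add: power2_diff sum.distrib sum_subtractf sum_distrib_left mult_ac)
qed

lemma sum_powers_le:
  fixes q :: real
  assumes "0 \<le> q" "q < 1"
  shows "(\<Sum>j\<in>{a..<b}. q ^ j) \<le> q ^ a / (1 - q)"
proof (cases "a \<le> b")
  case True
  then have "(1 - q) * (\<Sum>j\<in>{a..<b}. q ^ j) = q ^ a - q ^ b"
  proof (induction rule: dec_induct)
    case (step n)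
    then have "(1 - q) * (\<Sum>j\<in>{a..<Suc n}. q ^ j) = (q ^ a - q ^ n) + (1 - q) * q ^ n"
      by (simp add: distrib_left)
    then show ?case by (simp add: algebra_simps)
  qed simp
  also have "\<dots> \<le> q ^ a" using assms by simp
  finally show ?thesis using assms by (simp add: field_simps)
qed (use assms in simp)

definition basis_indices :: "nat \<Rightarrow> (nat \<times> nat) set" where
  "basis_indices J = Sigma {..<J} (\<lambda>j. {..<2 ^ j})"

text \<open>The half of Parseval's identity that is needed, in a form with finite sums only. The
  squared distance to an approximating combination equals the norm defect plus a nonnegative term,
  and dropping that term gives the claim.\<close>

lemma integral_square_le_coeffs:
  assumes \<psi>: "orthonormal_basis_unit \<psi>" and f: "f \<in> L2_unit" and "e > 0"
  shows "\<exists>J. (\<integral>x. (f x)\<^sup>2 \<partial>unit_law) \<le> e + (\<Sum>(j, k)\<in>basis_indices J. (inner_unit f (\<psi> j k))\<^sup>2)"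
proof -
  obtain J c where J: "(LINT x:{0..1}|lborel. (f x - (\<Sum>j<J. \<Sum>k<2 ^ j. c j k * \<psi> j k x))\<^sup>2) < e"
    using assms unfolding orthonormal_basis_unit_def by blast
  let ?S = "basis_indices J"
  let ?e = "\<lambda>p. \<psi> (fst p) (snd p)"
  have fin: "finite ?S" by (simp add: basis_indices_def)
  have e: "?e p \<in> L2_unit" if "p \<in> ?S" for p
    using that \<psi> by (auto simp: basis_indices_def orthonormal_basis_unit_def)
  have on: "inner_unit (?e p) (?e q) = (if p = q then 1 else 0)" if "p \<in> ?S" "q \<in> ?S" for p q
  proof -
    have "snd p < 2 ^ fst p" "snd q < 2 ^ fst q" using that by (auto simp: basis_indices_def)
    then show ?thesis using \<psi> by (simp add: orthonormal_basis_unit_def prod_eq_iff)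
  qed
  have eq: "(\<Sum>j<J. \<Sum>k<2 ^ j. c j k * \<psi> j k x) = (\<Sum>p\<in>?S. c (fst p) (snd p) * ?e p x)" for x
    by (simp add: basis_indices_def sum.Sigma case_prod_beta)
  have "(\<lambda>x. f x - (\<Sum>p\<in>?S. c (fst p) (snd p) * ?e p x)) \<in> L2_unit"
    using f fin e by (rule L2_unit_diff_sum)
  then have "(\<lambda>x. (f x - (\<Sum>p\<in>?S. c (fst p) (snd p) * ?e p x))\<^sup>2) \<in> borel_measurable borel"
    by (intro borel_measurable_power L2_unit_measurable)
  then have "(\<integral>x. (f x - (\<Sum>p\<in>?S. c (fst p) (snd p) * ?e p x))\<^sup>2 \<partial>unit_law) < e"
    using J unfolding eq by (simp add: set_integral_unit_law)
  then have "(\<integral>x. (f x)\<^sup>2 \<partial>unit_law) - (\<Sum>p\<in>?S. (inner_unit f (?e p))\<^sup>2) +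
      (\<Sum>p\<in>?S. (c (fst p) (snd p) - inner_unit f (?e p))\<^sup>2) < e"
    by (subst (asm) integral_square_diff_orthonormal[OF f fin e on])
  moreover have "(\<Sum>p\<in>?S. (c (fst p) (snd p) - inner_unit f (?e p))\<^sup>2) \<ge> 0"
    by (simp add: sum_nonneg)
  ultimately have "(\<integral>x. (f x)\<^sup>2 \<partial>unit_law) \<le> e + (\<Sum>p\<in>?S. (inner_unit f (?e p))\<^sup>2)" by linarith
  then show ?thesis by (auto simp: case_prod_beta)
qed

section \<open>Coefficient decay and bias on Besov balls\<close>

lemma besov_ball_level_le:
  assumes "f \<in> besov_ball s \<psi> L"
  shows "(\<Sum>k<2 ^ j. (inner_unit f (\<psi> j k))\<^sup>2) \<le> L\<^sup>2 * (2 powr (- 2 * s)) ^ j"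
proof -
  let ?A = "\<Sum>k<2 ^ j. (inner_unit f (\<psi> j k))\<^sup>2"
  have "ennreal (2 powr (2 * real j * s) * ?A) \<le> besov_norm_sq s \<psi> f"
    unfolding besov_norm_sq_def by (rule SUP_upper) simp
  also have "\<dots> \<le> ennreal (L\<^sup>2)" using assms by (simp add: besov_ball_def less_imp_le)
  finally have "2 powr (2 * real j * s) * ?A \<le> L\<^sup>2" by simp
  then have "?A \<le> L\<^sup>2 * 2 powr (- (2 * real j * s))" by (simp add: powr_minus field_simps)
  also have "2 powr (- (2 * real j * s)) = (2 powr (- 2 * s)) ^ j"
    by (simp add: powr_powr flip: powr_realpow) (simp add: mult_ac)
  finally show ?thesis .
qed

text \<open>The geometric bound on the levels from \<open>J0\<close> on does not depend on how many
  levels the approximation uses, so \<open>e\<close> can tend to 0. With \<open>S\<close> empty and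
  \<open>J0 = 0\<close> this also bounds the norm on the whole ball.\<close>

lemma besov_ball_bias_le:
  assumes \<psi>: "orthonormal_basis_unit \<psi>" and f: "f \<in> besov_ball s \<psi> L" and "s > 0"
    and S: "finite S" and J0: "\<And>j k. k < 2 ^ j \<Longrightarrow> j \<ge> J0 \<or> (j, k) \<in> S"
  shows "(\<integral>x. (f x)\<^sup>2 \<partial>unit_law) - (\<Sum>(j, k)\<in>S. (inner_unit f (\<psi> j k))\<^sup>2)
    \<le> L\<^sup>2 * (2 powr (- 2 * s)) ^ J0 / (1 - 2 powr (- 2 * s))"
proof (rule field_le_epsilon)
  fix e :: real assume "e > 0"
  let ?q = "2 powr (- 2 * s)" and ?c = "\<lambda>(j, k). (inner_unit f (\<psi> j k))\<^sup>2"
  have q: "?q < 1" using \<open>s > 0\<close> by (simp add: powr_less_one)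
  have fin: "finite (basis_indices J)" for J by (simp add: basis_indices_def)
  have c: "?c p \<ge> 0" for p by (simp add: case_prod_beta)
  have "f \<in> L2_unit" using f by (simp add: besov_ball_def)
  then obtain J where "(\<integral>x. (f x)\<^sup>2 \<partial>unit_law) \<le> e + sum ?c (basis_indices J)"
    using integral_square_le_coeffs[OF \<psi> _ \<open>e > 0\<close>] by blast
  \<comment> \<open>\<open>S\<close> may also contain indices of level \<open>J0\<close> or above.
    They are counted twice in the next step, which is harmless for an upper bound.\<close>
  also have "sum ?c (basis_indices J) \<le> sum ?c (S \<union> (SIGMA j:{J0..<J}. {..<2 ^ j}))"
    using J0 c S by (intro sum_mono2) (force simp: basis_indices_def)+
  also have "\<dots> \<le> sum ?c S + sum ?c (SIGMA j:{J0..<J}. {..<2 ^ j})"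
    using S c by (subst sum_Un) (auto intro!: sum_nonneg)
  also have "sum ?c (SIGMA j:{J0..<J}. {..<2 ^ j}) = (\<Sum>j\<in>{J0..<J}. \<Sum>k<2 ^ j. (inner_unit f (\<psi> j k))\<^sup>2)"
    by (simp add: sum.Sigma)
  also have "\<dots> \<le> (\<Sum>j\<in>{J0..<J}. L\<^sup>2 * ?q ^ j)"
    by (intro sum_mono besov_ball_level_le[OF f])
  also have "\<dots> \<le> L\<^sup>2 * (?q ^ J0 / (1 - ?q))"
    unfolding sum_distrib_left[symmetric] using q by (intro mult_left_mono sum_powers_le) auto
  finally show "(\<integral>x. (f x)\<^sup>2 \<partial>unit_law) - sum ?c S \<le> L\<^sup>2 * ?q ^ J0 / (1 - ?q) + e"
    by simp
qed

section \<open>Moments of the observations\<close>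

text \<open>Cross terms of independent centred variables vanish. The first two conclusions have the
  form of the hypotheses, so that the lemma can be applied again to a product of products:
  observations within a machine, then machines.\<close>

lemma sum_sq_PiM:
  fixes g :: "'i \<Rightarrow> 'a \<Rightarrow> real"
  assumes M: "prob_space M" and I: "finite I"
    and [measurable]: "\<And>i. i \<in> I \<Longrightarrow> g i \<in> borel_measurable M"
    and sq: "\<And>i. i \<in> I \<Longrightarrow> integrable M (\<lambda>x. (g i x)\<^sup>2)"
    and mean: "\<And>i. i \<in> I \<Longrightarrow> (\<integral>x. g i x \<partial>M) = 0"
  shows "integrable (\<Pi>\<^sub>M i\<in>I. M) (\<lambda>\<omega>. (\<Sum>i\<in>I. g i (\<omega> i))\<^sup>2)"
    and "(\<integral>\<omega>. (\<Sum>i\<in>I. g i (\<omega> i)) \<partial>(\<Pi>\<^sub>M i\<in>I. M)) = 0"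
    and "(\<integral>\<omega>. (\<Sum>i\<in>I. g i (\<omega> i))\<^sup>2 \<partial>(\<Pi>\<^sub>M i\<in>I. M)) = (\<Sum>i\<in>I. \<integral>x. (g i x)\<^sup>2 \<partial>M)"
proof -
  interpret M: prob_space M by fact
  interpret product_prob_space "\<lambda>_. M" I by unfold_locales
  have int: "integrable M (g i)" if "i \<in> I" for i
    using that by (auto intro!: M.square_integrable_imp_integrable[OF _ sq])
  \<comment> \<open>\<open>g i (\<omega> i) * g j (\<omega> j)\<close> as a product over all coordinates, to which independence applies\<close>
  define f where "f i j k = (\<lambda>x. (if k = i then g i x else 1) * (if k = j then g j x else (1::real)))" for i j k
  have fint: "integrable M (f i j k)" if "i \<in> I" "j \<in> I" for i j k
    unfolding f_def using that int[of i] int[of j] sq[of i]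
    by (cases "k = i"; cases "k = j") (simp_all add: power2_eq_square)
  have fprod: "(\<Prod>k\<in>I. f i j k (\<omega> k)) = g i (\<omega> i) * g j (\<omega> j)" if "i \<in> I" "j \<in> I" for i j \<omega>
    using that I unfolding f_def prod.distrib by simp
  have pint: "integrable (\<Pi>\<^sub>M i\<in>I. M) (\<lambda>\<omega>. g i (\<omega> i) * g j (\<omega> j))" if "i \<in> I" "j \<in> I" for i j
    using product_integrable_prod[of I "f i j", OF I fint[OF that]] fprod[OF that] by simp
  have peq: "(\<integral>\<omega>. g i (\<omega> i) * g j (\<omega> j) \<partial>(\<Pi>\<^sub>M i\<in>I. M)) = (if i = j then \<integral>x. (g i x)\<^sup>2 \<partial>M else 0)"
    if ij: "i \<in> I" "j \<in> I" for i j
  proof -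
    have "(\<integral>\<omega>. g i (\<omega> i) * g j (\<omega> j) \<partial>(\<Pi>\<^sub>M i\<in>I. M)) = (\<Prod>k\<in>I. integral\<^sup>L M (f i j k))"
      using product_integral_prod[of I "f i j", OF I fint[OF ij]] fprod[OF ij] by simp
    also have "\<dots> = (if i = j then \<integral>x. (g i x)\<^sup>2 \<partial>M else 0)"
    proof (cases "i = j")
      case True
      have "integral\<^sup>L M (f i j k) = (if k = i then \<integral>x. (g i x)\<^sup>2 \<partial>M else 1)" for k
        using True M.prob_space by (simp add: f_def power2_eq_square)
      then have "(\<Prod>k\<in>I. integral\<^sup>L M (f i j k)) = (\<integral>x. (g i x)\<^sup>2 \<partial>M)"
        using I ij by (simp only: prod.delta) simp
      then show ?thesis using True by simp
    next
      case False
      have "integral\<^sup>L M (f i j i) = 0" using False mean[OF ij(1)] by (simp add: f_def)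
      then have "(\<Prod>k\<in>I. integral\<^sup>L M (f i j k)) = 0" using I ij(1) by (intro prod_zero) blast+
      then show ?thesis using False by simp
    qed
    finally show ?thesis .
  qed
  have expand: "(\<Sum>i\<in>I. g i (\<omega> i))\<^sup>2 = (\<Sum>i\<in>I. \<Sum>j\<in>I. g i (\<omega> i) * g j (\<omega> j))" for \<omega>
    by (simp add: power2_eq_square sum_product)
  show "integrable (\<Pi>\<^sub>M i\<in>I. M) (\<lambda>\<omega>. (\<Sum>i\<in>I. g i (\<omega> i))\<^sup>2)"
    unfolding expand using pint by simp
  show "(\<integral>\<omega>. (\<Sum>i\<in>I. g i (\<omega> i))\<^sup>2 \<partial>(\<Pi>\<^sub>M i\<in>I. M)) = (\<Sum>i\<in>I. \<integral>x. (g i x)\<^sup>2 \<partial>M)"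
    unfolding expand using pint peq I by simp
  have comp: "(\<integral>\<omega>. g i (\<omega> i) \<partial>(\<Pi>\<^sub>M i\<in>I. M)) = 0 \<and> integrable (\<Pi>\<^sub>M i\<in>I. M) (\<lambda>\<omega>. g i (\<omega> i))"
    if i: "i \<in> I" for i
  proof -
    have d: "distr (\<Pi>\<^sub>M i\<in>I. M) M (\<lambda>\<omega>. \<omega> i) = M"
      using distr_PiM_component[of I "\<lambda>_. M" i] i M by simp
    have m: "(\<lambda>\<omega>. \<omega> i) \<in> (\<Pi>\<^sub>M i\<in>I. M) \<rightarrow>\<^sub>M M" using i by (rule measurable_component_singleton)
    have gm: "g i \<in> borel_measurable M" using i by simp
    show ?thesis
      using integral_distr[OF m gm] integrable_distr_eq[OF m gm] int[OF i] mean[OF i]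
      unfolding d by simp
  qed
  then show "(\<integral>\<omega>. (\<Sum>i\<in>I. g i (\<omega> i)) \<partial>(\<Pi>\<^sub>M i\<in>I. M)) = 0" by simp
qed

lemma nn_integral_PiM_component:
  assumes M: "prob_space M" and i: "i \<in> I" and f: "f \<in> borel_measurable M"
  shows "(\<integral>\<^sup>+\<omega>. f (\<omega> i) \<partial>(\<Pi>\<^sub>M i\<in>I. M)) = (\<integral>\<^sup>+x. f x \<partial>M)"
proof -
  have d: "distr (\<Pi>\<^sub>M i\<in>I. M) M (\<lambda>\<omega>. \<omega> i) = M"
    using distr_PiM_component[of I "\<lambda>_. M" i] i M by simp
  have m: "(\<lambda>\<omega>. \<omega> i) \<in> (\<Pi>\<^sub>M i\<in>I. M) \<rightarrow>\<^sub>M M" using i by (rule measurable_component_singleton)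
  show ?thesis using nn_integral_distr[OF m, of f] f unfolding d by simp
qed

section \<open>The law of one observation and the moments of response times wavelet\<close>

lemma sets_obs_law [simp, measurable_cong]: "sets (obs_law \<sigma> f) = sets borel"
  by (simp add: obs_law_def)

lemma prob_space_std_normal: "prob_space std_normal_distribution"
  by (rule prob_space_normal_density) simp

lemma std_normal_moments:
  "integrable std_normal_distribution (\<lambda>x. x)" "(\<integral>x. x \<partial>std_normal_distribution) = 0"
  "integrable std_normal_distribution (\<lambda>x. x\<^sup>2)" "(\<integral>x. x\<^sup>2 \<partial>std_normal_distribution) = 1"
  using integrable_std_normal_distribution_moment[of 1] integral_std_normal_distribution_moment_odd[of 1]
    integrable_std_normal_distribution_moment[of 2] std_normal_distribution_even_moments(1)[of 1]
  by simp_all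

context
  fixes f :: "real \<Rightarrow> real" and \<sigma> :: real
  assumes f [measurable]: "f \<in> borel_measurable borel"
begin

lemma measurable_observation:
  "(\<lambda>(t, e). (t, f t + \<sigma> * e)) \<in> unit_law \<Otimes>\<^sub>M std_normal_distribution \<rightarrow>\<^sub>M borel"
  unfolding borel_prod[symmetric] by measurable

lemma obs_law_eq:
  "obs_law \<sigma> f = distr (unit_law \<Otimes>\<^sub>M std_normal_distribution) borel (\<lambda>(t, e). (t, f t + \<sigma> * e))"
  by (simp add: obs_law_def unit_law_def)

lemma prob_space_obs_law: "prob_space (obs_law \<sigma> f)"
proof -
  interpret pair_prob_space unit_law std_normal_distribution
    by (intro pair_prob_space.intro pair_sigma_finite.intro prob_space_imp_sigma_finite
        prob_space_unit_law prob_space_std_normal)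
  show ?thesis unfolding obs_law_eq by (rule prob_space_distr[OF measurable_observation])
qed

lemma nn_integral_obs_law:
  assumes [measurable]: "g \<in> borel_measurable borel"
  shows "(\<integral>\<^sup>+z. g z \<partial>obs_law \<sigma> f) =
    (\<integral>\<^sup>+t. \<integral>\<^sup>+e. g (t, f t + \<sigma> * e) \<partial>std_normal_distribution \<partial>unit_law)"
proof -
  interpret N: prob_space std_normal_distribution by (rule prob_space_std_normal)
  have "(\<lambda>z. g (case z of (t, e) \<Rightarrow> (t, f t + \<sigma> * e))) \<in> borel_measurable (unit_law \<Otimes>\<^sub>M std_normal_distribution)"
    by (rule measurable_compose[OF measurable_observation]) simp
  from N.nn_integral_fst[OF this] show ?thesis
    unfolding obs_law_eq by (subst nn_integral_distr[OF measurable_observation]) simp_all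
qed

end

lemma measurable_response [measurable]:
  assumes "w \<in> borel_measurable borel"
  shows "(\<lambda>z. snd z * w (fst z)) \<in> borel_measurable (borel :: (real \<times> real) measure)"
  unfolding borel_prod[symmetric] using assms by measurable

lemma std_normal_affine_sq:
  "integrable std_normal_distribution (\<lambda>e. ((a + \<sigma> * e) * c)\<^sup>2)"
  "(\<integral>e. ((a + \<sigma> * e) * c)\<^sup>2 \<partial>std_normal_distribution) = (a\<^sup>2 + \<sigma>\<^sup>2) * c\<^sup>2"
proof -
  interpret N: prob_space std_normal_distribution by (rule prob_space_std_normal)
  have *: "((a + \<sigma> * e) * c)\<^sup>2 = a\<^sup>2 * c\<^sup>2 + 2 * a * \<sigma> * c\<^sup>2 * e + \<sigma>\<^sup>2 * c\<^sup>2 * e\<^sup>2" for e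
    by (simp add: power2_eq_square algebra_simps)
  show "integrable std_normal_distribution (\<lambda>e. ((a + \<sigma> * e) * c)\<^sup>2)"
    unfolding * by (intro Bochner_Integration.integrable_add integrable_mult_right std_normal_moments) simp
  show "(\<integral>e. ((a + \<sigma> * e) * c)\<^sup>2 \<partial>std_normal_distribution) = (a\<^sup>2 + \<sigma>\<^sup>2) * c\<^sup>2"
    unfolding * by (simp add: std_normal_moments N.prob_space[simplified] distrib_right del: integral_density)
qed

text \<open>Given the design point, the second moment is
  \<open>((f t)\<^sup>2 + \<sigma>\<^sup>2) * (w t)\<^sup>2\<close>. Taking the sup bound of
  \<open>f\<close> out of the integral leaves the norm of \<open>w\<close>, which is 1, so the bound
  is the same at every resolution level although wavelets grow with the level.\<close>

lemma nn_integral_response_sq_le: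
  assumes [measurable]: "f \<in> borel_measurable borel" and w: "w \<in> L2_unit" "inner_unit w w = 1"
    and M: "AE x in lborel. x \<in> {0..1} \<longrightarrow> \<bar>f x\<bar> \<le> M"
  shows "(\<integral>\<^sup>+z. ennreal ((snd z * w (fst z))\<^sup>2) \<partial>obs_law \<sigma> f) \<le> ennreal (M\<^sup>2 + \<sigma>\<^sup>2)"
proof -
  have [measurable]: "w \<in> borel_measurable borel" using w(1) by (rule L2_unit_measurable)
  have "(\<integral>\<^sup>+z. ennreal ((snd z * w (fst z))\<^sup>2) \<partial>obs_law \<sigma> f) =
      (\<integral>\<^sup>+t. \<integral>\<^sup>+e. ennreal (((f t + \<sigma> * e) * w t)\<^sup>2) \<partial>std_normal_distribution \<partial>unit_law)"
    by (subst nn_integral_obs_law) simp_all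
  also have "\<dots> = (\<integral>\<^sup>+t. ennreal (((f t)\<^sup>2 + \<sigma>\<^sup>2) * (w t)\<^sup>2) \<partial>unit_law)"
    by (subst nn_integral_eq_integral[OF std_normal_affine_sq(1)]) (simp_all only: std_normal_affine_sq(2), simp)
  also have "\<dots> \<le> (\<integral>\<^sup>+t. ennreal ((M\<^sup>2 + \<sigma>\<^sup>2) * (w t)\<^sup>2) \<partial>unit_law)"
  proof (rule nn_integral_mono_AE)
    have "AE t in unit_law. \<bar>f t\<bar> \<le> M"
      unfolding unit_law_def using M by (subst AE_uniform_measure) (auto elim!: eventually_mono)
    then show "AE t in unit_law. ennreal (((f t)\<^sup>2 + \<sigma>\<^sup>2) * (w t)\<^sup>2) \<le> ennreal ((M\<^sup>2 + \<sigma>\<^sup>2) * (w t)\<^sup>2)"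
      by eventually_elim (auto intro!: ennreal_leI mult_right_mono simp: abs_le_square_iff[symmetric])
  qed
  also have "\<dots> = ennreal ((M\<^sup>2 + \<sigma>\<^sup>2) * (\<integral>t. (w t)\<^sup>2 \<partial>unit_law))"
    using w(1) by (subst nn_integral_eq_integral) (auto simp: L2_unit_iff)
  also have "(\<integral>t. (w t)\<^sup>2 \<partial>unit_law) = 1"
    using w by (simp add: inner_unit_eq power2_eq_square)
  finally show ?thesis by simp
qed

text \<open>Both products, signal times wavelet and noise times wavelet, are bounded by half a sum
  of squares. Thus only the norm of \<open>f\<close> enters, and the bound is again independent of
  the level. The noise term contributes \<open>\<sigma> / 2\<close> from the wavelet and
  \<open>\<sigma> / 2\<close> from the unit variance.\<close>

lemma nn_integral_abs_response_le:
  assumes f: "f \<in> L2_unit" and w: "w \<in> L2_unit" "inner_unit w w = 1" and "\<sigma> \<ge> 0"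
  shows "(\<integral>\<^sup>+z. ennreal \<bar>snd z * w (fst z)\<bar> \<partial>obs_law \<sigma> f)
    \<le> ennreal (((\<integral>t. (f t)\<^sup>2 \<partial>unit_law) + 1) / 2 + \<sigma>)"
proof -
  interpret N: prob_space std_normal_distribution by (rule prob_space_std_normal)
  have [measurable]: "w \<in> borel_measurable borel" "f \<in> borel_measurable borel"
    using f w by (simp_all add: L2_unit_measurable)
  have bound: "\<bar>(a + \<sigma> * e) * c\<bar> \<le> (a\<^sup>2 + c\<^sup>2 + \<sigma> * c\<^sup>2) / 2 + \<sigma> / 2 * e\<^sup>2" for a c e :: real
  proof -
    have "\<bar>(a + \<sigma> * e) * c\<bar> \<le> \<bar>a\<bar> * \<bar>c\<bar> + \<sigma> * (\<bar>e\<bar> * \<bar>c\<bar>)"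
      using \<open>\<sigma> \<ge> 0\<close> abs_triangle_ineq[of "a * c" "\<sigma> * e * c"] by (simp add: abs_mult algebra_simps)
    also have "\<dots> \<le> (a\<^sup>2 + c\<^sup>2) / 2 + \<sigma> * ((e\<^sup>2 + c\<^sup>2) / 2)"
      using sum_squares_bound[of "\<bar>a\<bar>" "\<bar>c\<bar>"] sum_squares_bound[of "\<bar>e\<bar>" "\<bar>c\<bar>"] \<open>\<sigma> \<ge> 0\<close>
      by (intro add_mono mult_left_mono) (simp_all add: mult_ac)
    finally show ?thesis by (simp add: field_simps)
  qed
  have inner: "(\<integral>\<^sup>+e. ennreal \<bar>(a + \<sigma> * e) * c\<bar> \<partial>std_normal_distribution)
      \<le> ennreal ((a\<^sup>2 + c\<^sup>2 + \<sigma> * c\<^sup>2) / 2 + \<sigma> / 2)" for a c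
  proof -
    have "(\<integral>\<^sup>+e. ennreal \<bar>(a + \<sigma> * e) * c\<bar> \<partial>std_normal_distribution)
        \<le> (\<integral>\<^sup>+e. ennreal ((a\<^sup>2 + c\<^sup>2 + \<sigma> * c\<^sup>2) / 2 + \<sigma> / 2 * e\<^sup>2) \<partial>std_normal_distribution)"
      by (intro nn_integral_mono ennreal_leI bound)
    also have "\<dots> = ennreal (\<integral>e. (a\<^sup>2 + c\<^sup>2 + \<sigma> * c\<^sup>2) / 2 + \<sigma> / 2 * e\<^sup>2 \<partial>std_normal_distribution)"
      using \<open>\<sigma> \<ge> 0\<close>
      by (intro nn_integral_eq_integral Bochner_Integration.integrable_add integrable_mult_right
          std_normal_moments N.integrable_const AE_I2) simp
    also have "(\<integral>e. (a\<^sup>2 + c\<^sup>2 + \<sigma> * c\<^sup>2) / 2 + \<sigma> / 2 * e\<^sup>2 \<partial>std_normal_distribution) =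
        (a\<^sup>2 + c\<^sup>2 + \<sigma> * c\<^sup>2) / 2 + \<sigma> / 2"
      by (simp add: std_normal_moments N.prob_space[simplified] del: integral_density)
    finally show ?thesis .
  qed
  have ints: "integrable unit_law (\<lambda>t. (f t)\<^sup>2)" "integrable unit_law (\<lambda>t. (w t)\<^sup>2)"
    using f w by (simp_all add: L2_unit_iff)
  have w1: "(\<integral>t. (w t)\<^sup>2 \<partial>unit_law) = 1"
    using w by (simp add: inner_unit_eq power2_eq_square)
  interpret U: prob_space unit_law by (rule prob_space_unit_law)
  have "(\<integral>\<^sup>+z. ennreal \<bar>snd z * w (fst z)\<bar> \<partial>obs_law \<sigma> f) =
      (\<integral>\<^sup>+t. \<integral>\<^sup>+e. ennreal \<bar>(f t + \<sigma> * e) * w t\<bar> \<partial>std_normal_distribution \<partial>unit_law)"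
    by (subst nn_integral_obs_law) simp_all
  also have "\<dots> \<le> (\<integral>\<^sup>+t. ennreal (((f t)\<^sup>2 + (w t)\<^sup>2 + \<sigma> * (w t)\<^sup>2) / 2 + \<sigma> / 2) \<partial>unit_law)"
    by (intro nn_integral_mono inner)
  also have "\<dots> = ennreal (\<integral>t. ((f t)\<^sup>2 + (w t)\<^sup>2 + \<sigma> * (w t)\<^sup>2) / 2 + \<sigma> / 2 \<partial>unit_law)"
    using ints \<open>\<sigma> \<ge> 0\<close> by (intro nn_integral_eq_integral) auto
  also have "(\<integral>t. ((f t)\<^sup>2 + (w t)\<^sup>2 + \<sigma> * (w t)\<^sup>2) / 2 + \<sigma> / 2 \<partial>unit_law) =
      ((\<integral>t. (f t)\<^sup>2 \<partial>unit_law) + 1) / 2 + \<sigma>"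
    using ints by (simp add: w1 U.prob_space[simplified] field_simps)
  finally show ?thesis .
qed

text \<open>Unbiasedness of one summand: by Fubini the centred noise drops out for each fixed design
  point, and the uniform design turns the rest into the inner product.\<close>

lemma integral_response:
  assumes f: "f \<in> L2_unit" and w: "w \<in> L2_unit"
    and int: "integrable (obs_law \<sigma> f) (\<lambda>z. snd z * w (fst z))"
  shows "(\<integral>z. snd z * w (fst z) \<partial>obs_law \<sigma> f) = inner_unit f w"
proof -
  interpret N: prob_space std_normal_distribution by (rule prob_space_std_normal)
  have [measurable]: "w \<in> borel_measurable borel" "f \<in> borel_measurable borel"
    using f w by (simp_all add: L2_unit_measurable)
  note obs = measurable_observation[OF \<open>f \<in> borel_measurable borel\<close>, of \<sigma>]
  interpret pair_sigma_finite unit_law std_normal_distribution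
    by (intro pair_sigma_finite.intro prob_space_imp_sigma_finite prob_space_unit_law prob_space_std_normal)
  let ?g = "\<lambda>z. case z of (t, e) \<Rightarrow> (f t + \<sigma> * e) * w t"
  have g: "?g z = snd (case z of (t, e) \<Rightarrow> (t, f t + \<sigma> * e)) * w (fst (case z of (t, e) \<Rightarrow> (t, f t + \<sigma> * e)))" for z
    by (simp add: case_prod_beta)
  have int': "integrable (unit_law \<Otimes>\<^sub>M std_normal_distribution) ?g"
    using int unfolding obs_law_eq[OF \<open>f \<in> borel_measurable borel\<close>] g
    by (subst (asm) integrable_distr_eq[OF obs]) simp_all
  have "(\<integral>z. snd z * w (fst z) \<partial>obs_law \<sigma> f) = integral\<^sup>L (unit_law \<Otimes>\<^sub>M std_normal_distribution) ?g"
    unfolding obs_law_eq[OF \<open>f \<in> borel_measurable borel\<close>] g by (subst integral_distr[OF obs]) simp_all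
  also have "\<dots> = (\<integral>t. \<integral>e. (f t + \<sigma> * e) * w t \<partial>std_normal_distribution \<partial>unit_law)"
    using integral_fst'[OF int'] by simp
  also have "\<dots> = (\<integral>t. f t * w t \<partial>unit_law)"
  proof (rule Bochner_Integration.integral_cong[OF refl])
    fix t
    have *: "(f t + \<sigma> * e) * w t = f t * w t + \<sigma> * w t * e" for e by (simp add: algebra_simps)
    show "(\<integral>e. (f t + \<sigma> * e) * w t \<partial>std_normal_distribution) = f t * w t"
      unfolding * by (simp add: std_normal_moments N.prob_space[simplified] del: integral_density)
  qed
  also have "\<dots> = inner_unit f w" using f w by (simp add: inner_unit_eq)
  finally show ?thesis .
qed

section \<open>Transmission cost and risk\<close>

text \<open>Level \<open>j\<close> occupies the positions from \<open>2 ^ j\<close> to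
  \<open>2 ^ Suc j - 1\<close>, and these blocks are disjoint.\<close>

lemma dyadic_index_inj:
  assumes "(2::nat) ^ j + k = 2 ^ j' + k'" "k < 2 ^ j" "k' < 2 ^ j'"
  shows "j = j' \<and> k = k'"
proof -
  have *: False if "(2::nat) ^ j + k = 2 ^ j' + k'" "k < 2 ^ j" "j < j'" for j k j' k' :: nat
  proof -
    have "(2::nat) ^ Suc j \<le> 2 ^ j'" using that by (intro power_increasing) auto
    then show False using that by simp
  qed
  have "j = j'" using *[of j k j' k'] *[of j' k' j k] assms by (metis linorder_neqE_nat)
  then show ?thesis using assms by simp
qed

text \<open>Counting by position: \<open>2 ^ j + k\<close> maps the sent indices injectively into
  the integers between 1 and \<open>K\<close>.\<close>

lemma sent_indices_card:
  assumes "K = min (real n powr (1 / (1 + 2 * s))) (B / log 2 (real n))"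
  shows "finite (sent_indices s n B)" and "K \<ge> 0 \<Longrightarrow> real (card (sent_indices s n B)) \<le> K"
proof -
  let ?S = "sent_indices s n B" and ?pos = "\<lambda>p :: nat \<times> nat. 2 ^ fst p + snd p"
  have S: "snd p < 2 ^ fst p" "real (?pos p) \<le> K" if "p \<in> ?S" for p
    using that unfolding sent_indices_def assms by (simp_all add: case_prod_beta)
  have inj: "inj_on ?pos ?S"
  proof (rule inj_onI)
    fix p q assume "p \<in> ?S" "q \<in> ?S" "?pos p = ?pos q"
    then show "p = q" using dyadic_index_inj[of "fst p" "snd p" "fst q" "snd q"] S(1)
      by (simp add: prod_eq_iff)
  qed
  have im: "?pos ` ?S \<subseteq> {1..nat \<lfloor>K\<rfloor>}"
  proof
    fix i assume "i \<in> ?pos ` ?S"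
    then obtain p where p: "p \<in> ?S" "i = ?pos p" by blast
    then have "i \<le> nat \<lfloor>K\<rfloor>" using S(2)[OF p(1)] by (simp only: le_nat_floor)
    moreover have "1 \<le> i" unfolding p(2) by (simp add: Suc_le_eq)
    ultimately show "i \<in> {1..nat \<lfloor>K\<rfloor>}" by simp
  qed
  show "finite ?S" using finite_subset[OF im] inj by (simp add: finite_image_iff)
  assume K: "K \<ge> 0"
  have "card ?S \<le> card {1..nat \<lfloor>K\<rfloor>}"
    using card_image[OF inj] card_mono[OF _ im] by simp
  then have "real (card ?S) \<le> real (nat \<lfloor>K\<rfloor>)" by simp
  also have "\<dots> \<le> K" using K by simp
  finally show "real (card ?S) \<le> K" .
qed

lemma measurable_round_value [measurable]:
  "(\<lambda>x. round_value h (round_symbol h x)) \<in> borel_measurable borel"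
  unfolding round_value_def round_symbol_def by simp

lemma sets_local_law [simp]:
  "sets (\<Pi>\<^sub>M l\<in>{..<n div m}. obs_law \<sigma> f) = sets (local_space n m)"
  unfolding local_space_def by (intro sets_PiM_cong) auto

lemma measurable_local_coeff:
  assumes [measurable]: "\<psi> j k \<in> borel_measurable borel"
  shows "(\<lambda>d. local_coeff \<psi> n m d j k) \<in> borel_measurable (local_space n m)"
proof -
  have "(\<lambda>d. snd (d l) * \<psi> j k (fst (d l))) \<in> borel_measurable (local_space n m)" if "l \<in> {..<n div m}" for l
    unfolding local_space_def
    using measurable_compose[OF measurable_component_singleton[OF that] measurable_response[OF assms]]
    by simp
  then show ?thesis unfolding local_coeff_def by simp
qed

lemma nn_integral_abs_local_coeff_le:
  assumes f: "f \<in> L2_unit" and w: "\<psi> j k \<in> L2_unit" "inner_unit (\<psi> j k) (\<psi> j k) = 1" and "\<sigma> \<ge> 0"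
  shows "(\<integral>\<^sup>+d. ennreal \<bar>local_coeff \<psi> n m d j k\<bar> \<partial>(\<Pi>\<^sub>M l\<in>{..<n div m}. obs_law \<sigma> f))
    \<le> ennreal (((\<integral>t. (f t)\<^sup>2 \<partial>unit_law) + 1) / 2 + \<sigma>)"
proof -
  let ?P = "\<Pi>\<^sub>M l\<in>{..<n div m}. obs_law \<sigma> f" and ?A = "((\<integral>t. (f t)\<^sup>2 \<partial>unit_law) + 1) / 2 + \<sigma>"
  let ?X = "\<lambda>z. snd z * \<psi> j k (fst z)"
  have A: "?A \<ge> 0" using \<open>\<sigma> \<ge> 0\<close> by (intro add_nonneg_nonneg divide_nonneg_nonneg integral_nonneg_AE) auto
  have X [measurable]: "?X \<in> borel_measurable (obs_law \<sigma> f)"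
    using measurable_response[OF L2_unit_measurable[OF w(1)]] by simp
  have P: "prob_space (obs_law \<sigma> f)" by (rule prob_space_obs_law[OF L2_unit_measurable[OF f]])
  have "(\<integral>\<^sup>+d. ennreal \<bar>local_coeff \<psi> n m d j k\<bar> \<partial>?P) \<le>
      (\<integral>\<^sup>+d. (\<Sum>l<n div m. ennreal (real m / real n) * ennreal \<bar>?X (d l)\<bar>) \<partial>?P)"
  proof (rule nn_integral_mono)
    fix d
    have "\<bar>local_coeff \<psi> n m d j k\<bar> \<le> (\<Sum>l<n div m. real m / real n * \<bar>?X (d l)\<bar>)"
    proof -
      have "\<bar>local_coeff \<psi> n m d j k\<bar> = real m / real n * \<bar>\<Sum>l<n div m. ?X (d l)\<bar>"
        by (simp add: local_coeff_def abs_mult)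
      also have "\<dots> \<le> real m / real n * (\<Sum>l<n div m. \<bar>?X (d l)\<bar>)"
        by (intro mult_left_mono sum_abs) auto
      finally show ?thesis by (simp only: sum_distrib_left)
    qed
    then have "ennreal \<bar>local_coeff \<psi> n m d j k\<bar> \<le> ennreal (\<Sum>l<n div m. real m / real n * \<bar>?X (d l)\<bar>)"
      by (rule ennreal_leI)
    also have "\<dots> = (\<Sum>l<n div m. ennreal (real m / real n * \<bar>?X (d l)\<bar>))"
      by (subst sum_ennreal) auto
    also have "\<dots> = (\<Sum>l<n div m. ennreal (real m / real n) * ennreal \<bar>?X (d l)\<bar>)"
      by (intro sum.cong refl ennreal_mult) auto
    finally show "ennreal \<bar>local_coeff \<psi> n m d j k\<bar> \<le> \<dots>" .
  qed
  also have "\<dots> = (\<Sum>l<n div m. \<integral>\<^sup>+d. ennreal (real m / real n) * ennreal \<bar>?X (d l)\<bar> \<partial>?P)"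
    by (rule nn_integral_sum) measurable
  also have "\<dots> = (\<Sum>l<n div m. \<integral>\<^sup>+z. ennreal (real m / real n) * ennreal \<bar>?X z\<bar> \<partial>obs_law \<sigma> f)"
  proof (rule sum.cong[OF refl])
    fix l assume "l \<in> {..<n div m}"
    then show "(\<integral>\<^sup>+d. ennreal (real m / real n) * ennreal \<bar>?X (d l)\<bar> \<partial>?P) =
        (\<integral>\<^sup>+z. ennreal (real m / real n) * ennreal \<bar>?X z\<bar> \<partial>obs_law \<sigma> f)"
      by (intro nn_integral_PiM_component[OF P, where f="\<lambda>z. ennreal (real m / real n) * ennreal \<bar>?X z\<bar>"]) measurable
  qed
  also have "\<dots> = (\<Sum>l<n div m. ennreal (real m / real n) * (\<integral>\<^sup>+z. ennreal \<bar>?X z\<bar> \<partial>obs_law \<sigma> f))"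
    by (subst nn_integral_cmult) auto
  also have "\<dots> \<le> (\<Sum>l<n div m. ennreal (real m / real n) * ennreal ?A)"
    using nn_integral_abs_response_le[OF f w \<open>\<sigma> \<ge> 0\<close>] by (intro sum_mono mult_left_mono) auto
  also have "\<dots> = ennreal (real (n div m) * (real m / real n * ?A))"
    using A by (simp only: sum_constant card_lessThan ennreal_of_nat_eq_real_of_nat)
      (simp only: ennreal_mult mult_nonneg_nonneg divide_nonneg_nonneg of_nat_0_le_iff)
  also have "\<dots> \<le> ennreal ?A"
  proof (rule ennreal_leI)
    \<comment> \<open>The \<open>n div m\<close> summands carry the weight \<open>m / n\<close>
      each, so the weights sum to at most 1 and the bound for one observation carries over to the
      average.\<close>
    have "real (n div m) * real m \<le> real n"
      using div_times_less_eq_dividend[of n m] by (simp flip: of_nat_mult)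
    then have "real (n div m) * (real m / real n) \<le> 1"
      by (cases "n = 0") (simp_all add: divide_le_eq_1)
    from mult_right_mono[OF this A] show "real (n div m) * (real m / real n * ?A) \<le> ?A"
      by (simp add: mult.assoc)
  qed
  finally show ?thesis .
qed

text \<open>Although the average is formed in two stages, it weighs all \<open>n\<close>
  observations equally, so its variance is that of one summand divided by \<open>n\<close>, whatever
  the number of machines. The variance is at most the second moment.\<close>

lemma nn_integral_square_average_le:
  fixes X :: "'a \<Rightarrow> real"
  assumes P: "prob_space P" and X [measurable]: "X \<in> borel_measurable P"
    and sq: "integrable P (\<lambda>z. (X z)\<^sup>2)" and n: "n = m * q" "0 < n"
  defines "D \<equiv> (\<Pi>\<^sub>M i\<in>{..<m}. \<Pi>\<^sub>M l\<in>{..<q}. P)"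
  shows "(\<integral>\<^sup>+d. ennreal ((1 / real m * (\<Sum>i<m. real m / real n * (\<Sum>l<q. X (d i l))) - (\<integral>z. X z \<partial>P))\<^sup>2) \<partial>D)
    \<le> ennreal ((\<integral>z. (X z)\<^sup>2 \<partial>P) / real n)"
proof -
  interpret P: prob_space P by fact
  define \<mu> where "\<mu> = (\<integral>z. X z \<partial>P)"
  have int: "integrable P X" using X sq by (rule P.square_integrable_imp_integrable)
  define Z where "Z z = X z - \<mu>" for z
  have Z [measurable]: "Z \<in> borel_measurable P" unfolding Z_def by measurable
  have Z0: "(\<integral>z. Z z \<partial>P) = 0" using int by (simp add: Z_def \<mu>_def P.prob_space)
  have Zsq: "(Z z)\<^sup>2 = (X z)\<^sup>2 - 2 * \<mu> * X z + \<mu>\<^sup>2" for z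
    by (simp add: Z_def power2_eq_square algebra_simps)
  have Zint: "integrable P (\<lambda>z. (Z z)\<^sup>2)" unfolding Zsq using sq int by simp
  have "(\<integral>z. (Z z)\<^sup>2 \<partial>P) = (\<integral>z. (X z)\<^sup>2 \<partial>P) - \<mu>\<^sup>2"
    unfolding Zsq using sq int by (simp add: P.prob_space \<mu>_def[symmetric] power2_eq_square)
  then have Zle: "(\<integral>z. (Z z)\<^sup>2 \<partial>P) \<le> (\<integral>z. (X z)\<^sup>2 \<partial>P)" by simp
  let ?Q = "\<Pi>\<^sub>M l\<in>{..<q}. P" and ?G = "\<lambda>x. \<Sum>l<q. Z (x l)"
  \<comment> \<open>The sum over one machine is square-integrable and centred by \<open>in1\<close>,
    which is what \<open>in2\<close> requires of a single coordinate of the outer product.\<close>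
  note in1 = sum_sq_PiM[OF P, of "{..<q}" "\<lambda>_. Z", OF _ Z Zint Z0]
  have Q: "prob_space ?Q" by (intro prob_space_PiM P)
  have G: "?G \<in> borel_measurable ?Q" by measurable
  note in2 = sum_sq_PiM[OF Q, of "{..<m}" "\<lambda>_. ?G", OF _ G in1(1) in1(2)]
  have intD: "integrable D (\<lambda>d. (\<Sum>i<m. ?G (d i))\<^sup>2)"
    unfolding D_def using in2(1) by simp
  have eqD: "(\<integral>d. (\<Sum>i<m. ?G (d i))\<^sup>2 \<partial>D) = real n * (\<integral>z. (Z z)\<^sup>2 \<partial>P)"
    unfolding D_def using in2(3) in1(3) n by simp
  have m: "0 < m" using n by (cases m) auto
  have dev: "1 / real m * (\<Sum>i<m. real m / real n * (\<Sum>l<q. X (d i l))) - \<mu> = (\<Sum>i<m. ?G (d i)) / real n" for d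
  proof -
    have "(\<Sum>i<m. ?G (d i)) = (\<Sum>i<m. \<Sum>l<q. X (d i l)) - real n * \<mu>"
      by (simp add: Z_def sum_subtractf n)
    moreover have "(\<Sum>i<m. real m / real n * (\<Sum>l<q. X (d i l))) = real m / real n * (\<Sum>i<m. \<Sum>l<q. X (d i l))"
      by (rule sum_distrib_left[symmetric])
    ultimately show ?thesis using m n(2) by (simp only:) (simp add: field_simps)
  qed
  have "(\<integral>\<^sup>+d. ennreal ((1 / real m * (\<Sum>i<m. real m / real n * (\<Sum>l<q. X (d i l))) - \<mu>)\<^sup>2) \<partial>D) =
      (\<integral>\<^sup>+d. ennreal ((\<Sum>i<m. ?G (d i))\<^sup>2 / (real n)\<^sup>2) \<partial>D)"
    unfolding dev by (simp add: power_divide)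
  also have "\<dots> = ennreal (real n * (\<integral>z. (Z z)\<^sup>2 \<partial>P) / (real n)\<^sup>2)"
    using intD by (subst nn_integral_eq_integral) (auto simp: eqD)
  also have "real n * (\<integral>z. (Z z)\<^sup>2 \<partial>P) / (real n)\<^sup>2 = (\<integral>z. (Z z)\<^sup>2 \<partial>P) / real n"
    by (simp add: power2_eq_square)
  also have "ennreal \<dots> \<le> ennreal ((\<integral>z. (X z)\<^sup>2 \<partial>P) / real n)"
    using Zle by (intro ennreal_leI divide_right_mono) auto
  finally show ?thesis unfolding \<mu>_def .
qed

section \<open>Sampling and rounding error of the estimated coefficients, and the risk\<close>

definition coeff_estimate ::
  "(nat \<Rightarrow> nat \<Rightarrow> real \<Rightarrow> real) \<Rightarrow> nat \<Rightarrow> nat \<Rightarrow> (nat \<Rightarrow> local_data) \<Rightarrow> nat \<Rightarrow> nat \<Rightarrow> real" where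
  "coeff_estimate \<psi> n m d j k =
     1 / real m * (\<Sum>i<m. trans_value n (trans_approx n (local_coeff \<psi> n m (d i) j k)))"

lemma sets_data_law: "sets (data_law \<sigma> n m f) = sets (\<Pi>\<^sub>M i\<in>{..<m}. local_space n m)"
  unfolding data_law_def by (intro sets_PiM_cong) auto

lemma measurable_local_coeff_component:
  assumes "\<psi> j k \<in> borel_measurable borel" "i < m"
  shows "(\<lambda>d. local_coeff \<psi> n m (d i) j k) \<in> borel_measurable (data_law \<sigma> n m f)"
proof -
  have "(\<lambda>d. d i) \<in> (\<Pi>\<^sub>M i\<in>{..<m}. local_space n m) \<rightarrow>\<^sub>M local_space n m"
    using assms(2) by (intro measurable_component_singleton) simp
  from measurable_compose[OF this measurable_local_coeff[where \<psi>=\<psi>, OF assms(1)]] show ?thesis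
    unfolding measurable_cong_sets[OF sets_data_law refl] .
qed

lemma measurable_coeff_estimate:
  assumes "\<psi> j k \<in> borel_measurable borel" "1 \<le> n"
  shows "(\<lambda>d. coeff_estimate \<psi> n m d j k) \<in> borel_measurable (data_law \<sigma> n m f)"
proof -
  have "(\<lambda>d. trans_value n (trans_approx n (local_coeff \<psi> n m (d i) j k))) \<in> borel_measurable (data_law \<sigma> n m f)"
    if "i \<in> {..<m}" for i
    unfolding trans_value_trans_approx[OF assms(2)] using that
    by (intro measurable_compose[OF measurable_local_coeff_component measurable_round_value] assms) simp
  then show ?thesis unfolding coeff_estimate_def by simp
qed

text \<open>The unrounded average \<open>avg\<close> separates the two errors. By
  \<open>(a + b)\<^sup>2 \<le> 2 * a\<^sup>2 + 2 * b\<^sup>2\<close>, the sampling error contributes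
  \<open>2 * (M\<^sup>2 + \<sigma>\<^sup>2) / n\<close> and rounding contributes
  \<open>2 * 4 / n\<close>.\<close>

lemma nn_integral_coeff_estimate_le:
  assumes f: "f \<in> L2_unit" and w: "\<psi> j k \<in> L2_unit" "inner_unit (\<psi> j k) (\<psi> j k) = 1"
    and M: "AE x in lborel. x \<in> {0..1} \<longrightarrow> \<bar>f x\<bar> \<le> M" and n: "1 \<le> n" "1 \<le> m" "m dvd n"
  shows "(\<integral>\<^sup>+d. ennreal ((coeff_estimate \<psi> n m d j k - inner_unit f (\<psi> j k))\<^sup>2) \<partial>data_law \<sigma> n m f)
    \<le> ennreal ((2 * (M\<^sup>2 + \<sigma>\<^sup>2) + 8) / real n)"
proof -
  let ?P = "obs_law \<sigma> f" and ?X = "\<lambda>z. snd z * \<psi> j k (fst z)" and ?D = "data_law \<sigma> n m f"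
  let ?\<mu> = "inner_unit f (\<psi> j k)"
  have P: "prob_space ?P" by (rule prob_space_obs_law[OF L2_unit_measurable[OF f]])
  interpret P: prob_space ?P by fact
  have X [measurable]: "?X \<in> borel_measurable ?P"
    using measurable_response[OF L2_unit_measurable[OF w(1)]] by simp
  note sqle = nn_integral_response_sq_le[OF L2_unit_measurable[OF f] w M, of \<sigma>]
  have sq: "integrable ?P (\<lambda>z. (?X z)\<^sup>2)"
  proof (rule integrableI_bounded)
    show "(\<integral>\<^sup>+z. ennreal (norm ((?X z)\<^sup>2)) \<partial>?P) < \<infinity>"
      using le_less_trans[OF sqle ennreal_less_top] by simp
  qed measurable
  have "ennreal (\<integral>z. (?X z)\<^sup>2 \<partial>?P) \<le> ennreal (M\<^sup>2 + \<sigma>\<^sup>2)"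
    using sqle sq by (subst (asm) nn_integral_eq_integral) auto
  then have sqle': "(\<integral>z. (?X z)\<^sup>2 \<partial>?P) \<le> M\<^sup>2 + \<sigma>\<^sup>2" by (subst (asm) ennreal_le_iff) simp_all
  have mean: "(\<integral>z. ?X z \<partial>?P) = ?\<mu>"
    using X sq by (intro integral_response f w(1)) (rule P.square_integrable_imp_integrable)
  define avg where "avg d = 1 / real m * (\<Sum>i<m. local_coeff \<psi> n m (d i) j k)" for d
  have D: "?D = (\<Pi>\<^sub>M i\<in>{..<m}. \<Pi>\<^sub>M l\<in>{..<n div m}. ?P)" by (simp add: data_law_def)
  have "(\<integral>\<^sup>+d. ennreal ((avg d - ?\<mu>)\<^sup>2) \<partial>?D) \<le> ennreal ((\<integral>z. (?X z)\<^sup>2 \<partial>?P) / real n)"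
    unfolding avg_def local_coeff_def D mean[symmetric]
    using n by (intro nn_integral_square_average_le[OF P X sq]) auto
  also have "\<dots> \<le> ennreal ((M\<^sup>2 + \<sigma>\<^sup>2) / real n)"
    using sqle' by (intro ennreal_leI divide_right_mono) auto
  finally have avg: "(\<integral>\<^sup>+d. ennreal ((avg d - ?\<mu>)\<^sup>2) \<partial>?D) \<le> ennreal ((M\<^sup>2 + \<sigma>\<^sup>2) / real n)" .
  have meas: "(\<lambda>d. ennreal ((avg d - ?\<mu>)\<^sup>2)) \<in> borel_measurable ?D"
    using measurable_local_coeff_component[where \<psi>=\<psi>, OF L2_unit_measurable[OF w(1)]]
    unfolding avg_def by simp
  \<comment> \<open>The rounding error is bounded for every data set, and averaging over machines
    cannot increase a uniform bound. Its dependence on the noise is therefore irrelevant.\<close>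
  have pt: "(coeff_estimate \<psi> n m d j k - ?\<mu>)\<^sup>2 \<le> 2 * (avg d - ?\<mu>)\<^sup>2 + 8 / real n" for d
  proof -
    define h where "h = precision n"
    have "\<bar>\<Sum>i<m. trans_value n (trans_approx n (local_coeff \<psi> n m (d i) j k)) - local_coeff \<psi> n m (d i) j k\<bar>
        \<le> (\<Sum>i<m. \<bar>trans_value n (trans_approx n (local_coeff \<psi> n m (d i) j k)) - local_coeff \<psi> n m (d i) j k\<bar>)"
      by (rule sum_abs)
    also have "\<dots> \<le> (\<Sum>i<m. 1 / 2 ^ h)"
      unfolding trans_value_trans_approx[OF n(1)] h_def by (intro sum_mono round_error)
    finally have "\<bar>\<Sum>i<m. trans_value n (trans_approx n (local_coeff \<psi> n m (d i) j k)) - local_coeff \<psi> n m (d i) j k\<bar>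
        \<le> real m * (1 / 2 ^ h)" by simp
    moreover have "(\<Sum>i<m. trans_value n (trans_approx n (local_coeff \<psi> n m (d i) j k)) - local_coeff \<psi> n m (d i) j k) =
        real m * (coeff_estimate \<psi> n m d j k - avg d)"
      using n(2) by (simp add: coeff_estimate_def avg_def sum_subtractf right_diff_distrib)
    ultimately have "real m * \<bar>coeff_estimate \<psi> n m d j k - avg d\<bar> \<le> real m * (1 / 2 ^ h)"
      by (simp add: abs_mult)
    then have "\<bar>coeff_estimate \<psi> n m d j k - avg d\<bar> \<le> \<bar>1 / 2 ^ h\<bar>"
      using n(2) by (subst (asm) mult_le_cancel_left_pos) simp_all
    then have "(coeff_estimate \<psi> n m d j k - avg d)\<^sup>2 \<le> (1 / 2 ^ h)\<^sup>2" by (simp only: abs_le_square_iff)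
    also have "\<dots> \<le> 4 / real n" unfolding h_def by (rule inverse_power_precision_le[OF n(1)])
    finally have q: "(coeff_estimate \<psi> n m d j k - avg d)\<^sup>2 \<le> 4 / real n" .
    have "(a + b)\<^sup>2 \<le> 2 * a\<^sup>2 + 2 * b\<^sup>2" for a b :: real
      using sum_squares_bound[of a b] by (simp add: power2_sum)
    from this[of "avg d - ?\<mu>" "coeff_estimate \<psi> n m d j k - avg d"] q show ?thesis by simp
  qed
  interpret D: prob_space ?D unfolding D by (intro prob_space_PiM P)
  have double: "ennreal (2 * x) = 2 * ennreal x" if "0 \<le> x" for x
    using that by (simp add: ennreal_mult)
  have "(\<integral>\<^sup>+d. ennreal ((coeff_estimate \<psi> n m d j k - ?\<mu>)\<^sup>2) \<partial>?D) \<le>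
      (\<integral>\<^sup>+d. 2 * ennreal ((avg d - ?\<mu>)\<^sup>2) + ennreal (8 / real n) \<partial>?D)"
  proof (rule nn_integral_mono)
    fix d
    have "ennreal ((coeff_estimate \<psi> n m d j k - ?\<mu>)\<^sup>2) \<le> ennreal (2 * (avg d - ?\<mu>)\<^sup>2 + 8 / real n)"
      by (rule ennreal_leI[OF pt])
    also have "\<dots> = 2 * ennreal ((avg d - ?\<mu>)\<^sup>2) + ennreal (8 / real n)"
      by (subst ennreal_plus) (auto simp: double)
    finally show "ennreal ((coeff_estimate \<psi> n m d j k - ?\<mu>)\<^sup>2) \<le> \<dots>" .
  qed
  also have "\<dots> = 2 * (\<integral>\<^sup>+d. ennreal ((avg d - ?\<mu>)\<^sup>2) \<partial>?D) + ennreal (8 / real n)"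
    using meas by (simp add: nn_integral_add nn_integral_cmult D.emeasure_space_1)
  also have "\<dots> \<le> 2 * ennreal ((M\<^sup>2 + \<sigma>\<^sup>2) / real n) + ennreal (8 / real n)"
    using avg by (intro add_right_mono mult_left_mono) auto
  also have "\<dots> = ennreal (2 * ((M\<^sup>2 + \<sigma>\<^sup>2) / real n) + 8 / real n)"
  proof -
    have v: "0 \<le> (M\<^sup>2 + \<sigma>\<^sup>2) / real n" by simp
    have "0 \<le> 8 / real n" by simp
    from ennreal_plus[OF mult_nonneg_nonneg[OF zero_le_numeral v] this] show ?thesis
      by (simp only: double[OF v])
  qed
  also have "2 * ((M\<^sup>2 + \<sigma>\<^sup>2) / real n) + 8 / real n = (2 * (M\<^sup>2 + \<sigma>\<^sup>2) + 8) / real n"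
    by (simp add: add_divide_distrib)
  finally show ?thesis .
qed

lemma risk_le:
  assumes \<psi>: "orthonormal_basis_unit \<psi>" and f: "f \<in> L2_unit"
    and M: "AE x in lborel. x \<in> {0..1} \<longrightarrow> \<bar>f x\<bar> \<le> M" and n: "1 \<le> n" "1 \<le> m" "m dvd n"
    and bias: "(\<integral>x. (f x)\<^sup>2 \<partial>unit_law) - (\<Sum>(j, k)\<in>sent_indices s n B. (inner_unit f (\<psi> j k))\<^sup>2) \<le> b"
  shows "risk \<sigma> n m (dist_estimator \<psi> s n m B) f
    \<le> ennreal (real (card (sent_indices s n B)) * ((2 * (M\<^sup>2 + \<sigma>\<^sup>2) + 8) / real n) + b)"
proof -
  let ?S = "sent_indices s n B" and ?D = "data_law \<sigma> n m f"
  let ?e = "\<lambda>p. \<psi> (fst p) (snd p)"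
  let ?a = "\<lambda>d p. coeff_estimate \<psi> n m d (fst p) (snd p)"
  let ?v = "(2 * (M\<^sup>2 + \<sigma>\<^sup>2) + 8) / real n"
  have fin: "finite ?S" by (rule sent_indices_card(1)[OF refl])
  have lt: "snd p < 2 ^ fst p" if "p \<in> ?S" for p using that by (auto simp: sent_indices_def)
  have e: "?e p \<in> L2_unit" if "p \<in> ?S" for p
    using lt[OF that] \<psi> by (auto simp: orthonormal_basis_unit_def)
  have on: "inner_unit (?e p) (?e q) = (if p = q then 1 else 0)" if "p \<in> ?S" "q \<in> ?S" for p q
    using lt[OF that(1)] lt[OF that(2)] \<psi> by (simp add: orthonormal_basis_unit_def prod_eq_iff)
  let ?b = "(\<integral>x. (f x)\<^sup>2 \<partial>unit_law) - (\<Sum>p\<in>?S. (inner_unit f (?e p))\<^sup>2)"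
  have b: "?b \<le> b" using bias by (simp add: case_prod_beta)
  \<comment> \<open>Bessel's inequality. It makes \<open>b\<close> nonnegative, which is needed
    because \<open>ennreal\<close> sends negative reals to 0 and is additive only on nonnegative
    ones.\<close>
  have b0: "?b \<ge> 0"
  proof -
    have "0 \<le> (\<integral>x. (f x - (\<Sum>p\<in>?S. inner_unit f (?e p) * ?e p x))\<^sup>2 \<partial>unit_law)" by simp
    also have "\<dots> = ?b" by (subst integral_square_diff_orthonormal[OF f fin e on]) simp_all
    finally show ?thesis .
  qed
  have loss: "(\<integral>\<^sup>+t\<in>{0..1}. ennreal ((dist_estimator \<psi> s n m B d t - f t)\<^sup>2) \<partial>lborel)
      \<le> (\<Sum>p\<in>?S. ennreal ((?a d p - inner_unit f (?e p))\<^sup>2)) + ennreal b" for d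
  proof -
    let ?r = "\<lambda>t. f t - (\<Sum>p\<in>?S. ?a d p * ?e p t)"
    have r: "?r \<in> L2_unit" by (rule L2_unit_diff_sum[OF f fin e])
    have est: "dist_estimator \<psi> s n m B d t = (\<Sum>p\<in>?S. ?a d p * ?e p t)" for t
      by (simp add: dist_estimator_def coeff_estimate_def case_prod_beta)
    have "(\<integral>\<^sup>+t\<in>{0..1}. ennreal ((dist_estimator \<psi> s n m B d t - f t)\<^sup>2) \<partial>lborel) =
        (\<integral>\<^sup>+t\<in>{0..1}. ennreal ((?r t)\<^sup>2) \<partial>lborel)"
      unfolding est by (simp add: power2_commute)
    also have "\<dots> = (\<integral>\<^sup>+t. ennreal ((?r t)\<^sup>2) \<partial>unit_law)"
      by (rule nn_integral_unit_law) (use L2_unit_measurable[OF r] in measurable)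
    also have "\<dots> = ennreal (\<integral>t. (?r t)\<^sup>2 \<partial>unit_law)"
      using r by (intro nn_integral_eq_integral) (auto simp: L2_unit_iff)
    also have "(\<integral>t. (?r t)\<^sup>2 \<partial>unit_law) = ?b + (\<Sum>p\<in>?S. (?a d p - inner_unit f (?e p))\<^sup>2)"
      by (rule integral_square_diff_orthonormal[OF f fin e on])
    also have "ennreal \<dots> \<le> ennreal ((\<Sum>p\<in>?S. (?a d p - inner_unit f (?e p))\<^sup>2) + b)"
      using b by (intro ennreal_leI) simp
    also have "\<dots> = (\<Sum>p\<in>?S. ennreal ((?a d p - inner_unit f (?e p))\<^sup>2)) + ennreal b"
      using b b0 by (subst ennreal_plus) (auto intro!: sum_nonneg)
    finally show ?thesis .
  qed
  have P: "prob_space (obs_law \<sigma> f)" by (rule prob_space_obs_law[OF L2_unit_measurable[OF f]])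
  interpret D: prob_space ?D unfolding data_law_def by (intro prob_space_PiM P)
  have meas: "(\<lambda>d. ennreal ((?a d p - inner_unit f (?e p))\<^sup>2)) \<in> borel_measurable ?D" if "p \<in> ?S" for p
    using measurable_coeff_estimate[where \<psi>=\<psi> and j="fst p" and k="snd p" and m=m and \<sigma>=\<sigma> and f=f,
        OF L2_unit_measurable[OF e[OF that]] n(1)] by simp
  have "risk \<sigma> n m (dist_estimator \<psi> s n m B) f \<le>
      (\<integral>\<^sup>+d. (\<Sum>p\<in>?S. ennreal ((?a d p - inner_unit f (?e p))\<^sup>2)) + ennreal b \<partial>?D)"
    unfolding risk_def by (intro nn_integral_mono loss)
  also have "\<dots> = (\<Sum>p\<in>?S. \<integral>\<^sup>+d. ennreal ((?a d p - inner_unit f (?e p))\<^sup>2) \<partial>?D) + ennreal b"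
    using meas by (simp add: nn_integral_add nn_integral_sum D.emeasure_space_1 del: sum_ennreal)
  also have "\<dots> \<le> (\<Sum>p\<in>?S. ennreal ?v) + ennreal b"
  proof (intro add_right_mono sum_mono)
    fix p assume p: "p \<in> ?S"
    have "inner_unit (?e p) (?e p) = 1" using on[OF p p] by simp
    from nn_integral_coeff_estimate_le[where \<psi>=\<psi>, OF f e[OF p] this M n]
    show "(\<integral>\<^sup>+d. ennreal ((?a d p - inner_unit f (?e p))\<^sup>2) \<partial>?D) \<le> ennreal ?v" .
  qed
  also have "\<dots> = ennreal (real (card ?S) * ?v + b)"
  proof -
    have "ennreal (real (card ?S) * ?v + b) = ennreal (real (card ?S) * ?v) + ennreal b"
      using b b0 by (intro ennreal_plus) auto
    also have "ennreal (real (card ?S) * ?v) = ennreal (real (card ?S)) * ennreal ?v"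
      by (intro ennreal_mult) auto
    finally show ?thesis by (simp add: ennreal_of_nat_eq_real_of_nat)
  qed
  finally show ?thesis .
qed

text \<open>The witnesses are the concatenated Rice codewords and their decoder. The hypothesis
  \<open>large\<close> makes the expected length of a codeword at most \<open>log 2 n\<close>, and
  at most \<open>B / log 2 n\<close> codewords are sent.\<close>

lemma dist_estimator_in_dist_estimators:
  assumes \<psi>: "orthonormal_basis_unit \<psi>" and "\<sigma> \<ge> 0" and n: "2 \<le> n" and "B \<ge> 0"
    and F: "\<And>f. f \<in> F \<Longrightarrow> f \<in> L2_unit" "\<And>f. f \<in> F \<Longrightarrow> (\<integral>x. (f x)\<^sup>2 \<partial>unit_law) \<le> R"
    and large: "2 + (R + 1) / 2 + \<sigma> \<le> log 2 (real n) / 2"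
  shows "dist_estimator \<psi> s n m B \<in> dist_estimators \<sigma> n m (\<lambda>_. B) F"
proof -
  let ?S = "sent_indices s n B"
  define h where "h = precision n"
  have n1: "1 \<le> n" using n by simp
  have fin: "finite ?S" by (rule sent_indices_card(1)[OF refl])
  then obtain ps where ps: "set ps = ?S" "distinct ps" using finite_distinct_list by blast
  define x where "x d = (\<lambda>p. local_coeff \<psi> n m d (fst p) (snd p))" for d
  define Y :: "nat \<Rightarrow> local_data \<Rightarrow> bool list" where "Y i d = send h ps (x d)" for i d
  define g where "g y t = (\<Sum>p\<in>?S. 1 / real m * (\<Sum>i<m. receive h ps (y i) p) * \<psi> (fst p) (snd p) t)"
    for y :: "nat \<Rightarrow> bool list" and t
  have \<psi>': "\<psi> (fst p) (snd p) \<in> L2_unit" "inner_unit (\<psi> (fst p) (snd p)) (\<psi> (fst p) (snd p)) = 1"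
    if "p \<in> ?S" for p
  proof -
    have "snd p < 2 ^ fst p" using that by (auto simp: sent_indices_def)
    then show "\<psi> (fst p) (snd p) \<in> L2_unit" "inner_unit (\<psi> (fst p) (snd p)) (\<psi> (fst p) (snd p)) = 1"
      using \<psi> by (auto simp: orthonormal_basis_unit_def)
  qed
  have x: "(\<lambda>d. x d p) \<in> borel_measurable (local_space n m)" if "p \<in> ?S" for p
    unfolding x_def by (intro measurable_local_coeff L2_unit_measurable \<psi>' that)
  have Y: "Y i \<in> local_space n m \<rightarrow>\<^sub>M count_space UNIV" for i
    unfolding Y_def[abs_def] using x ps by (intro measurable_send) auto
  have g: "(\<lambda>(y, t). g y t) \<in> borel_measurable ((\<Pi>\<^sub>M i\<in>{..<m}. count_space UNIV) \<Otimes>\<^sub>M borel)" (is "_ \<in> borel_measurable ?M")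
  proof -
    have r: "(\<lambda>z. receive h ps (fst z i) p) \<in> borel_measurable ?M" if "i \<in> {..<m}" for i p
    proof -
      have "(\<lambda>z. fst z i) \<in> ?M \<rightarrow>\<^sub>M count_space UNIV"
        using that by (rule measurable_compose[OF measurable_fst measurable_component_singleton])
      then show ?thesis
        by (rule measurable_compose[where g="\<lambda>ys. receive h ps ys p"]) simp
    qed
    have p: "(\<lambda>z. \<psi> (fst p) (snd p) (snd z)) \<in> borel_measurable ?M" if "p \<in> ?S" for p
      by (rule measurable_compose[OF measurable_snd L2_unit_measurable[OF \<psi>'(1)[OF that]]])
    show ?thesis unfolding g_def case_prod_beta
      by (intro borel_measurable_sum borel_measurable_times borel_measurable_const r p)
  qed
  have gL2: "g y \<in> L2_unit" for y
    unfolding g_def[abs_def] using \<psi>' by (intro L2_unit_sum L2_unit_mult_left fin) auto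
  have est: "dist_estimator \<psi> s n m B d = g (\<lambda>i\<in>{..<m}. Y i (d i))" for d
  proof
    fix t
    have "receive h ps (Y i (d i)) p = trans_value n (trans_approx n (local_coeff \<psi> n m (d i) (fst p) (snd p)))"
      if "p \<in> ?S" for i p
      using that ps unfolding Y_def by (simp add: receive_send trans_value_trans_approx[OF n1] h_def x_def)
    then show "dist_estimator \<psi> s n m B d t = g (\<lambda>i\<in>{..<m}. Y i (d i)) t"
      unfolding dist_estimator_def g_def case_prod_beta by (intro sum.cong) simp_all
  qed
  have len: "(\<integral>\<^sup>+d. of_nat (length (Y i (d i))) \<partial>data_law \<sigma> n m f) \<le> ennreal B" if f: "f \<in> F" and i: "i < m" for f i
  proof -
    let ?Q = "\<Pi>\<^sub>M l\<in>{..<n div m}. obs_law \<sigma> f" and ?A = "(R + 1) / 2 + \<sigma>"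
    have P: "prob_space (obs_law \<sigma> f)" by (rule prob_space_obs_law[OF L2_unit_measurable[OF F(1)[OF f]]])
    then have Q: "prob_space ?Q" by (intro prob_space_PiM)
    interpret Q: prob_space ?Q by (rule Q)
    have "0 \<le> (\<integral>x. (f x)\<^sup>2 \<partial>unit_law)" by simp
    then have R: "0 \<le> R" using F(2)[OF f] by linarith
    \<comment> \<open>The \<open>h\<close> fractional digits take at most half of
      \<open>log 2 n\<close>; by \<open>large\<close> the other half covers the two marker bits and
      the expected unary part, which is at most \<open>?A\<close>.\<close>
    have c: "2 + real h + ?A \<le> log 2 (real n)"
      using large precision_le[OF n1] unfolding h_def by (simp add: field_simps)
    have log: "0 < log 2 (real n)" using n by simp
    have abs: "(\<integral>\<^sup>+d. ennreal \<bar>x d p\<bar> \<partial>?Q) \<le> ennreal ?A" if "p \<in> ?S" for p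
    proof -
      have "(\<integral>\<^sup>+d. ennreal \<bar>x d p\<bar> \<partial>?Q) \<le> ennreal (((\<integral>t. (f t)\<^sup>2 \<partial>unit_law) + 1) / 2 + \<sigma>)"
        unfolding x_def by (intro nn_integral_abs_local_coeff_le F f \<psi>' that \<open>\<sigma> \<ge> 0\<close>)
      also have "\<dots> \<le> ennreal ?A" using F(2)[OF f] by (intro ennreal_leI) simp
      finally show ?thesis .
    qed
    have "Y i \<in> ?Q \<rightarrow>\<^sub>M count_space UNIV"
      using Y unfolding measurable_cong_sets[OF sets_local_law refl] by simp
    then have "(\<lambda>d. of_nat (length (Y i d)) :: ennreal) \<in> borel_measurable ?Q"
      by (rule measurable_compose) simp
    then have "(\<integral>\<^sup>+d. of_nat (length (Y i (d i))) \<partial>data_law \<sigma> n m f) = (\<integral>\<^sup>+d. of_nat (length (Y i d)) \<partial>?Q)"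
      unfolding data_law_def using i by (intro nn_integral_PiM_component[OF Q]) auto
    also have "\<dots> \<le> (\<integral>\<^sup>+d. (\<Sum>p\<in>?S. ennreal (2 + real h) + ennreal \<bar>x d p\<bar>) \<partial>?Q)"
    proof (rule nn_integral_mono)
      fix d
      have "ennreal (real (length (Y i d))) \<le> ennreal (\<Sum>p\<in>?S. 2 + real h + \<bar>x d p\<bar>)"
        unfolding Y_def using length_send_le[OF ps(2)] ps(1) by (intro ennreal_leI) simp
      also have "\<dots> = (\<Sum>p\<in>?S. ennreal (2 + real h + \<bar>x d p\<bar>))"
        by (rule sum_ennreal[symmetric]) simp
      also have "\<dots> = (\<Sum>p\<in>?S. ennreal (2 + real h) + ennreal \<bar>x d p\<bar>)"
        by (intro sum.cong refl ennreal_plus) simp_all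
      finally show "of_nat (length (Y i d)) \<le> \<dots>" by (simp add: ennreal_of_nat_eq_real_of_nat)
    qed
    also have "\<dots> = (\<Sum>p\<in>?S. \<integral>\<^sup>+d. ennreal (2 + real h) + ennreal \<bar>x d p\<bar> \<partial>?Q)"
    proof (rule nn_integral_sum)
      fix p assume "p \<in> ?S"
      then have "(\<lambda>d. x d p) \<in> borel_measurable ?Q"
        using x unfolding measurable_cong_sets[OF sets_local_law refl] by simp
      then show "(\<lambda>d. ennreal (2 + real h) + ennreal \<bar>x d p\<bar>) \<in> borel_measurable ?Q" by simp
    qed
    also have "\<dots> = (\<Sum>p\<in>?S. ennreal (2 + real h) + (\<integral>\<^sup>+d. ennreal \<bar>x d p\<bar> \<partial>?Q))"
    proof (rule sum.cong[OF refl])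
      fix p assume "p \<in> ?S"
      then have "(\<lambda>d. x d p) \<in> borel_measurable ?Q"
        using x unfolding measurable_cong_sets[OF sets_local_law refl] by simp
      then show "(\<integral>\<^sup>+d. ennreal (2 + real h) + ennreal \<bar>x d p\<bar> \<partial>?Q) =
          ennreal (2 + real h) + (\<integral>\<^sup>+d. ennreal \<bar>x d p\<bar> \<partial>?Q)"
        by (subst nn_integral_add) (simp_all add: Q.emeasure_space_1)
    qed
    also have "\<dots> \<le> (\<Sum>p\<in>?S. ennreal (2 + real h) + ennreal ?A)"
      using abs by (intro sum_mono add_left_mono)
    also have "\<dots> = (\<Sum>p\<in>?S. ennreal (2 + real h + ?A))"
      using R \<open>\<sigma> \<ge> 0\<close> by (intro sum.cong refl ennreal_plus[symmetric]) auto
    also have "\<dots> \<le> (\<Sum>p\<in>?S. ennreal (log 2 (real n)))"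
      using c by (intro sum_mono ennreal_leI)
    also have "\<dots> = ennreal (real (card ?S) * log 2 (real n))"
      using log by (simp add: ennreal_mult ennreal_of_nat_eq_real_of_nat)
    also have "\<dots> \<le> ennreal B"
    proof (rule ennreal_leI)
      have "real (card ?S) \<le> B / log 2 (real n)"
        using sent_indices_card(2)[OF refl, of n s B] \<open>B \<ge> 0\<close> log by simp
      then show "real (card ?S) * log 2 (real n) \<le> B" using log by (simp add: field_simps)
    qed
    finally show ?thesis .
  qed
  show ?thesis
    unfolding dist_estimators_def using Y g gL2 est len by blast
qed

text \<open>Sending by position may cut a level in the middle. The bound treats level
  \<open>J\<close> as if nothing of it were sent, which costs only a constant factor.\<close>

lemma bias_le_powr:
  assumes \<psi>: "orthonormal_basis_unit \<psi>" and f: "f \<in> besov_ball s \<psi> L" and "s > 0"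
    and K: "K = min (real n powr (1 / (1 + 2 * s))) (B / log 2 (real n))" "K > 0"
  shows "(\<integral>x. (f x)\<^sup>2 \<partial>unit_law) - (\<Sum>(j, k)\<in>sent_indices s n B. (inner_unit f (\<psi> j k))\<^sup>2)
    \<le> L\<^sup>2 * 4 powr s / (1 - 2 powr (- 2 * s)) * K powr (- 2 * s)"
proof -
  let ?q = "2 powr (- 2 * s)"
  \<comment> \<open>the first level that need not be sent completely, as level \<open>j\<close> occupies the positions below \<open>2 ^ Suc j\<close>\<close>
  define J where "J = (LEAST j. K < 2 ^ Suc j)"
  have "\<exists>j. K < 2 ^ Suc j"
    using real_arch_pow[of 2 K] by (metis dual_order.strict_trans lessI numeral_less_iff one_less_numeral_iff power_strict_increasing semiring_norm(76))
  then have J: "K < 2 ^ Suc J" unfolding J_def by (rule LeastI_ex)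
  have mem: "j \<ge> J \<or> (j, k) \<in> sent_indices s n B" if "k < 2 ^ j" for j k
  proof (cases "J \<le> j")
    case False
    then have "2 ^ Suc j \<le> K" using not_less_Least[of j "\<lambda>j. K < 2 ^ Suc j"] unfolding J_def by simp
    moreover have "real (2 ^ j + k) \<le> 2 ^ Suc j" using that by (simp flip: of_nat_power_less_of_nat_cancel_iff)
    ultimately have "real (2 ^ j + k) \<le> K" by linarith
    then show ?thesis using that unfolding sent_indices_def K(1) by simp
  qed simp
  have q: "?q < 1" using \<open>s > 0\<close> by (simp add: powr_less_one)
  have "?q ^ J = (2 ^ J) powr (- 2 * s)"
    by (simp add: powr_powr flip: powr_realpow) (simp add: mult_ac)
  \<comment> \<open>By the choice of \<open>J\<close>, \<open>K / 2 < 2 ^ J\<close>, and the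
    exponent is negative. The factor \<open>4 powr s\<close> comes from the 2 in
    \<open>K / 2\<close>.\<close>
  also have "\<dots> \<le> (K / 2) powr (- 2 * s)"
    using J K(2) \<open>s > 0\<close> by (intro powr_mono2') (simp_all add: field_simps)
  also have "\<dots> = 4 powr s * K powr (- 2 * s)"
  proof -
    have "(4::real) powr s = 2 powr (2 * s)" using powr_powr[of 2 2 s] by simp
    then show ?thesis using K(2) by (simp add: powr_divide powr_minus field_simps)
  qed
  finally have qJ: "?q ^ J \<le> 4 powr s * K powr (- 2 * s)" .
  have "(\<integral>x. (f x)\<^sup>2 \<partial>unit_law) - (\<Sum>(j, k)\<in>sent_indices s n B. (inner_unit f (\<psi> j k))\<^sup>2)
      \<le> L\<^sup>2 * ?q ^ J / (1 - ?q)"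
    by (rule besov_ball_bias_le[OF \<psi> f \<open>s > 0\<close> sent_indices_card(1)[OF refl] mem])
  also have "\<dots> \<le> L\<^sup>2 * (4 powr s * K powr (- 2 * s)) / (1 - ?q)"
    using qJ q by (intro divide_right_mono mult_left_mono) auto
  finally show ?thesis by (simp add: mult_ac)
qed

text \<open>Both constants are built from \<open>s\<close>, \<open>L\<close>, \<open>M\<close> and
  \<open>\<sigma>\<close> alone, hence uniform in the basis and in \<open>n\<close>,
  \<open>m\<close>, \<open>B\<close>. The threshold \<open>n0\<close> makes room for the constant
  overhead per codeword and concerns only the budget; the risk estimate covers every
  \<open>n\<close> from 2 on.\<close>

theorem theorem2p4:
  fixes s L M \<sigma> :: real
  assumes "s > 0" and "L > 0" and "M > 0" and "\<sigma> > 0"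
  shows "\<exists>C > 0. \<exists>n0 :: nat. \<forall>N \<psi> (n :: nat) (m :: nat) (B :: real).
    cdv_basis N \<psi> \<longrightarrow> real N > s \<longrightarrow>
    2 \<le> n \<longrightarrow> 1 \<le> m \<longrightarrow> m \<le> n \<longrightarrow> m dvd n \<longrightarrow>
    B \<ge> real n powr (1 / (1 + 2 * s)) / log 2 (real n) \<longrightarrow>
      (n \<ge> n0 \<longrightarrow>
        dist_estimator \<psi> s n m B \<in> dist_estimators \<sigma> n m (\<lambda>_. B) (besov_ball s \<psi> L)) \<and>
      (SUP f0 \<in> {f \<in> besov_ball s \<psi> L. AE x in lborel. x \<in> {0..1} \<longrightarrow> \<bar>f x\<bar> \<le> M}.
         risk \<sigma> n m (dist_estimator \<psi> s n m B) f0)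
      \<le> ennreal (C * (L powr (2 / (1 + 2 * s)) *
           max (real n powr (- (2 * s) / (1 + 2 * s))) ((B / log 2 (real n)) powr (- 2 * s))))"
proof -
  define q where "q = 2 powr (- 2 * s)"
  have q: "0 < q" "q < 1" using \<open>s > 0\<close> by (simp_all add: q_def powr_less_one)
  \<comment> \<open>The squared norm of a member of the ball is at most the sum of the level bounds
    \<open>L\<^sup>2 * q ^ j\<close> over all \<open>j\<close>.\<close>
  define R where "R = L\<^sup>2 / (1 - q)"
  define v where "v = 2 * (M\<^sup>2 + \<sigma>\<^sup>2) + 8"
  define b where "b = L\<^sup>2 * 4 powr s / (1 - q)"
  define \<Lambda> where "\<Lambda> = L powr (2 / (1 + 2 * s))"
  \<comment> \<open>The argument yields the rate with the factor \<open>v + b\<close>. As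
    \<open>C\<close> may depend on \<open>L\<close>, division by \<open>\<Lambda>\<close> produces
    the power of \<open>L\<close> in the claim.\<close>
  define C where "C = (v + b) / \<Lambda>"
  define n0 where "n0 = nat \<lceil>2 powr (2 * (2 + (R + 1) / 2 + \<sigma>))\<rceil>"
  have v: "v > 0" unfolding v_def by (simp add: add_nonneg_pos)
  have b: "b \<ge> 0" using q by (simp add: b_def)
  have \<Lambda>: "\<Lambda> > 0" using \<open>L > 0\<close> by (simp add: \<Lambda>_def)
  have member: "dist_estimator \<psi> s n m B \<in> dist_estimators \<sigma> n m (\<lambda>_. B) (besov_ball s \<psi> L)"
    if \<psi>: "orthonormal_basis_unit \<psi>" and n: "2 \<le> n" "n0 \<le> n" and B: "B \<ge> 0" for \<psi> n m B
  proof (rule dist_estimator_in_dist_estimators[OF \<psi> _ n(1) B])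
    show "\<sigma> \<ge> 0" using \<open>\<sigma> > 0\<close> by simp
    show "f \<in> L2_unit" if "f \<in> besov_ball s \<psi> L" for f using that by (simp add: besov_ball_def)
    show "(\<integral>x. (f x)\<^sup>2 \<partial>unit_law) \<le> R" if f: "f \<in> besov_ball s \<psi> L" for f
      using besov_ball_bias_le[OF \<psi> f \<open>s > 0\<close> finite.emptyI, of 0] by (simp add: R_def q_def)
    have "2 powr (2 * (2 + (R + 1) / 2 + \<sigma>)) \<le> real n" using n(2) unfolding n0_def by linarith
    then have "2 * (2 + (R + 1) / 2 + \<sigma>) \<le> log 2 (real n)" using n(1) by (subst le_log_iff) auto
    then show "2 + (R + 1) / 2 + \<sigma> \<le> log 2 (real n) / 2" by (simp add: field_simps)
  qed
  have bound: "risk \<sigma> n m (dist_estimator \<psi> s n m B) f \<le> ennreal (C * (\<Lambda> *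
      max (real n powr (- (2 * s) / (1 + 2 * s))) ((B / log 2 (real n)) powr (- 2 * s))))"
    if \<psi>: "orthonormal_basis_unit \<psi>" and n: "2 \<le> n" "1 \<le> m" "m dvd n" and B: "B > 0"
      and f: "f \<in> besov_ball s \<psi> L" and M: "AE x in lborel. x \<in> {0..1} \<longrightarrow> \<bar>f x\<bar> \<le> M"
    for \<psi> n m B f
  proof -
    let ?S = "sent_indices s n B" and ?e = "1 / (1 + 2 * s)"
    define K where "K = min (real n powr ?e) (B / log 2 (real n))"
    define \<rho> where "\<rho> = max (real n powr (- (2 * s) / (1 + 2 * s))) ((B / log 2 (real n)) powr (- 2 * s))"
    have n1: "1 \<le> n" using n by simp
    have K: "K > 0" using n B by (simp add: K_def)
    have e: "(real n powr ?e) powr (- 2 * s) = real n powr (- (2 * s) / (1 + 2 * s))"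
      by (simp add: powr_powr)
    \<comment> \<open>\<open>K\<close> is one of the two terms of the minimum, and its power is the
      corresponding term of the maximum.\<close>
    have \<rho>: "K powr (- 2 * s) \<le> \<rho>"
      unfolding \<rho>_def e[symmetric] by (simp add: K_def min_def)
    \<comment> \<open>The cap at \<open>n powr ?e\<close> limits the variance: \<open>?e - 1\<close>
      is the exponent of the first term in the maximum.\<close>
    have "real (card ?S) * (v / real n) \<le> real n powr ?e * (v / real n)"
      using sent_indices_card(2)[OF K_def] K v by (intro mult_right_mono) (simp_all add: K_def)
    also have "\<dots> = v * real n powr (?e - 1)"
      using n by (simp add: powr_diff)
    also have "?e - 1 = - (2 * s) / (1 + 2 * s)"
      using \<open>s > 0\<close> by (simp add: field_simps)
    also have "v * real n powr (- (2 * s) / (1 + 2 * s)) \<le> v * \<rho>"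
      using v by (intro mult_left_mono) (simp_all add: \<rho>_def)
    finally have var: "real (card ?S) * (v / real n) \<le> v * \<rho>" .
    have L2: "f \<in> L2_unit" using f by (simp add: besov_ball_def)
    have "risk \<sigma> n m (dist_estimator \<psi> s n m B) f
        \<le> ennreal (real (card ?S) * (v / real n) + b * K powr (- 2 * s))"
      unfolding v_def b_def q_def
      by (rule risk_le[OF \<psi> L2 M n1 n(2,3) bias_le_powr[OF \<psi> f \<open>s > 0\<close> K_def K]])
    also have "\<dots> \<le> ennreal (v * \<rho> + b * \<rho>)"
      using var \<rho> b by (intro ennreal_leI add_mono mult_left_mono)
    also have "v * \<rho> + b * \<rho> = C * (\<Lambda> * \<rho>)" using \<Lambda> by (simp add: C_def field_simps)
    finally show ?thesis unfolding \<rho>_def .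
  qed
  have "C > 0" using v b \<Lambda> by (simp add: C_def add_pos_nonneg)
  moreover have "B > 0" if "2 \<le> n" "B \<ge> real n powr (1 / (1 + 2 * s)) / log 2 (real n)" for n :: nat and B
  proof -
    have "0 < real n powr (1 / (1 + 2 * s)) / log 2 (real n)" using that(1) by simp
    then show ?thesis using that(2) by linarith
  qed
  moreover have "orthonormal_basis_unit \<psi>" if "cdv_basis N \<psi>" for N \<psi>
    using that by (simp add: cdv_basis_def)
  ultimately show ?thesis
    using member bound unfolding \<Lambda>_def
    by (intro exI[of _ C] conjI exI[of _ n0] allI impI SUP_least) (auto simp: less_imp_le)
qed

end
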